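(* Let $Q\in\mathrm{SO}(3)$. The adjoint of $\mathcal T_Q\colon L^2(\mathrm{SO}(3))\to L^2([0,\pi])$ is given by $$\mathcal T_Q^*g(A)=g(d_Q(A))\qquad\text{for all }A\in\mathrm{SO}(3),$$ and the adjoint of $\mathcal T\colon L^2(\mathrm{SO}(3))\to L^2(\mathrm{SO}(3)\times[0,\pi])$ is given by $$\mathcal T^*g(A)=\frac{1}{8\pi^2}\int_{\mathrm{SO}(3)}g(Q,d_Q(A))\,\mathrm d\sigma_{\mathrm{SO}(3)}(Q)\qquad\text{for all }A\in\mathrm{SO}(3).$$
   Context: For $\mathbf n\in\mathbb S^2$ and $\omega\in\mathbb R$, $\mathrm R_{\mathbf n}(\omega)=(1-\cos\omega)\,\mathbf n\mathbf n^\top+\cos\omega\, I+\sin\omega\,[\mathbf n]_\times$ (with $[\mathbf n]_\times x=\mathbf n\times x$) is the rotation with axis $\mathbf n$ and angle $\omega$. The rotation angle of $Q\in\mathrm{SO}(3)$ is $\angle(Q)=\arccos\frac{\operatorname{trace}(Q)-1}{2}\in[0,\pi]$, and $d_Q\colon\mathrm{SO}(3)\to[0,\pi]$, $d_Q(P)=\angle(Q^\top P)$. $\sigma_{\mathrm{SO}(3)}$ is the rotation-invariant measure on $\mathrm{SO}(3)$ with total mass $8\pi^2$, i.e. $\int_{\mathrm{SO}(3)}f\,\mathrm d\sigma_{\mathrm{SO}(3)}=2\int_0^\pi\int_{\mathbb S^2}f(\mathrm R_\xi(\omega))(1-\cos\omega)\,\mathrm d\sigma_{\mathbb S^2}(\xi)\,\mathrm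 d\omega$, with $\sigma_{\mathbb S^2}$ the surface measure. $L^2(\mathrm{SO}(3))$ is taken with respect to $\sigma_{\mathrm{SO}(3)}$, $L^2([0,\pi])$ with respect to Lebesgue measure, and $L^2(\mathrm{SO}(3)\times[0,\pi])$ with respect to the product measure. The Radon transform is $$\mathcal Tf(Q,\omega)=\frac{1}{4\pi^2}(1-\cos\omega)\int_{\mathbb S^2}f(Q\,\mathrm R_\xi(\omega))\,\mathrm d\sigma_{\mathbb S^2}(\xi),\qquad Q\in\mathrm{SO}(3),\ \omega\in[0,\pi],$$ and its restriction is $\mathcal T_Qf(\omega)=8\pi^2\,\mathcal Tf(Q,\omega)$. *)

theory Defs
  imports "HOL-Analysis.Analysis"
begin

section \<open>Rotations\<close>

definition SO3 :: "(real^3^3) set" where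
  "SO3 = {Q. rotation_matrix Q}"

definition rot :: "real^3 \<Rightarrow> real \<Rightarrow> real^3^3" where
  "rot n \<omega> = (1 - cos \<omega>) *\<^sub>R (\<chi> i j. n $ i * n $ j) + cos \<omega> *\<^sub>R mat 1 + sin \<omega> *\<^sub>R matrix (cross3 n)"

definition rot_angle :: "real^3^3 \<Rightarrow> real" where
  "rot_angle Q = arccos ((trace Q - 1) / 2)"

definition rot_dist :: "real^3^3 \<Rightarrow> real^3^3 \<Rightarrow> real" where
  "rot_dist Q P = rot_angle (transpose Q ** P)"

section \<open>Measures\<close>

text \<open>
  Every measure lives on the Borel sigma-algebra of its space. Thus \<open>angles\<close> is Lebesgue
  measure on the Borel sets of \<open>[0, \<pi>]\<close>. Its completion has the same \<open>L\<^sup>2\<close> classes, but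
  \<open>g \<circ> rot_dist Q\<close> need not be Borel measurable for a merely Lebesgue measurable \<open>g\<close>.
\<close>

definition angles :: "real measure" where
  "angles = restrict_space lborel {0..pi}"

text \<open>The surface measure is \<open>sin \<theta> d\<phi> d\<theta>\<close> in spherical coordinates.\<close>

definition sph :: "real \<times> real \<Rightarrow> real^3" where
  "sph = (\<lambda>(\<phi>, \<theta>). vector [cos \<phi> * sin \<theta>, sin \<phi> * sin \<theta>, cos \<theta>])"

definition sphere_measure :: "(real^3) measure" where
  "sphere_measure =
     distr (density (restrict_space lborel {0..2*pi} \<Otimes>\<^sub>M angles) (\<lambda>(\<phi>, \<theta>). ennreal (sin \<theta>)))
       (restrict_space borel (sphere 0 1)) sph"

text \<open>
  The rotation-invariant measure of total mass \<open>8\<pi>\<^sup>2\<close>, given by its axis-angle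
  formula; see \<open>nn_integral_SO3_measure\<close> below for the formula as an integral.
\<close>

definition SO3_measure :: "(real^3^3) measure" where
  "SO3_measure =
     distr (density (angles \<Otimes>\<^sub>M sphere_measure) (\<lambda>(\<omega>, \<xi>). ennreal (2 * (1 - cos \<omega>))))
       (restrict_space borel SO3) (\<lambda>(\<omega>, \<xi>). rot \<xi> \<omega>)"

section \<open>Square-integrable functions and adjoints\<close>

text \<open>
  Elements of \<open>L\<^sup>2\<close> are handled through complex-valued representatives, and
  equality of classes is equality almost everywhere.
\<close>

definition L2 :: "'x measure \<Rightarrow> ('x \<Rightarrow> complex) set" where
  "L2 M = {f \<in> borel_measurable M. integrable M (\<lambda>x. (cmod (f x))\<^sup>2)}"

definition L2_inner :: "'x measure \<Rightarrow> ('x \<Rightarrow> complex) \<Rightarrow> ('x \<Rightarrow> complex) \<Rightarrow> complex" where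
  "L2_inner M f g = (\<integral>x. f x * cnj (g x) \<partial>M)"

definition L2_norm :: "'x measure \<Rightarrow> ('x \<Rightarrow> complex) \<Rightarrow> real" where
  "L2_norm M f = sqrt (\<integral>x. (cmod (f x))\<^sup>2 \<partial>M)"

text \<open>
  Linearity is required only almost everywhere, since an integral transform of a
  representative may diverge on a null set (and the Bochner integral is then 0). Linearity and
  boundedness together imply that almost everywhere equal arguments have almost everywhere
  equal images, so that the operator acts on classes.
\<close>

definition L2_bounded_linear ::
    "'x measure \<Rightarrow> 'y measure \<Rightarrow> (('x \<Rightarrow> complex) \<Rightarrow> 'y \<Rightarrow> complex) \<Rightarrow> bool" where
  "L2_bounded_linear M N T \<longleftrightarrow>
     (\<forall>f\<in>L2 M. T f \<in> L2 N) \<and>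
     (\<forall>f\<in>L2 M. \<forall>h\<in>L2 M. AE y in N. T (\<lambda>x. f x + h x) y = T f y + T h y) \<and>
     (\<forall>c. \<forall>f\<in>L2 M. AE y in N. T (\<lambda>x. c * f x) y = c * T f y) \<and>
     (\<exists>C. \<forall>f\<in>L2 M. L2_norm N (T f) \<le> C * L2_norm M f)"

definition is_L2_adjoint ::
    "'x measure \<Rightarrow> 'y measure \<Rightarrow> (('x \<Rightarrow> complex) \<Rightarrow> 'y \<Rightarrow> complex)
      \<Rightarrow> (('y \<Rightarrow> complex) \<Rightarrow> 'x \<Rightarrow> complex) \<Rightarrow> bool" where
  "is_L2_adjoint M N T S \<longleftrightarrow>
     L2_bounded_linear M N T \<and> L2_bounded_linear N M S \<and>
     (\<forall>f\<in>L2 M. \<forall>g\<in>L2 N. L2_inner N (T f) g = L2_inner M f (S g))"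

section \<open>The Radon transform\<close>

definition radon :: "(real^3^3 \<Rightarrow> complex) \<Rightarrow> (real^3^3) \<times> real \<Rightarrow> complex" where
  "radon f = (\<lambda>(Q, \<omega>). of_real (1 / (4 * pi\<^sup>2) * (1 - cos \<omega>)) *
                (\<integral>\<xi>. f (Q ** rot \<xi> \<omega>) \<partial>sphere_measure))"

definition radon_at :: "real^3^3 \<Rightarrow> (real^3^3 \<Rightarrow> complex) \<Rightarrow> real \<Rightarrow> complex" where
  "radon_at Q f \<omega> = of_real (8 * pi\<^sup>2) * radon f (Q, \<omega>)"

section \<open>Integral formulas for the measures\<close>

text \<open>
  \<^const>\<open>distr\<close> is only meaningful for measurable maps; these lemmas confirm that the maps above
  are measurable into the sphere and into \<^const>\<open>SO3\<close>.
\<close>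

lemma sph_in_sphere: "sph p \<in> sphere 0 1"
proof -
  obtain \<phi> \<theta> where p: "p = (\<phi>, \<theta>)" by fastforce
  have "(cos \<phi> * sin \<theta>)\<^sup>2 + (sin \<phi> * sin \<theta>)\<^sup>2 + (cos \<theta>)\<^sup>2
      = ((sin \<phi>)\<^sup>2 + (cos \<phi>)\<^sup>2) * (sin \<theta>)\<^sup>2 + (cos \<theta>)\<^sup>2"
    unfolding power_mult_distrib distrib_right by simp
  also have "\<dots> = 1" by simp
  finally show ?thesis
    by (simp add: p sph_def norm_vec_def L2_set_def sum_3)
qed

lemma rot_in_SO3:
  assumes "\<xi> \<in> sphere 0 1"
  shows "rot \<xi> \<omega> \<in> SO3"
proof -
  define a b c where abc: "a = \<xi> $ 1" "b = \<xi> $ 2" "c = \<xi> $ 3"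
  define s t where st_def: "s = sin \<omega>" "t = cos \<omega>"
  have n: "a\<^sup>2 + b\<^sup>2 + c\<^sup>2 = 1"
    using assms by (simp add: norm_vec_def L2_set_def sum_3 abc)
  have st: "s\<^sup>2 + t\<^sup>2 = 1" by (simp add: st_def)
  have e: "rot \<xi> \<omega> $ 1 $ 1 = (1-t)*a*a + t" "rot \<xi> \<omega> $ 1 $ 2 = (1-t)*a*b - s*c"
    "rot \<xi> \<omega> $ 1 $ 3 = (1-t)*a*c + s*b" "rot \<xi> \<omega> $ 2 $ 1 = (1-t)*b*a + s*c"
    "rot \<xi> \<omega> $ 2 $ 2 = (1-t)*b*b + t" "rot \<xi> \<omega> $ 2 $ 3 = (1-t)*b*c - s*a"
    "rot \<xi> \<omega> $ 3 $ 1 = (1-t)*c*a - s*b" "rot \<xi> \<omega> $ 3 $ 2 = (1-t)*c*b + s*a"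
    "rot \<xi> \<omega> $ 3 $ 3 = (1-t)*c*c + t"
    by (simp_all add: rot_def matrix_def cross3_def mat_def axis_def abc st_def)
  have "transpose (rot \<xi> \<omega>) ** rot \<xi> \<omega> = mat 1"
    unfolding vec_eq_iff forall_3
    apply (simp add: matrix_matrix_mult_def transpose_def sum_3 mat_def e)
    apply (intro conjI)
    subgoal using n st by algebra
    subgoal using n st by algebra
    subgoal using n st by algebra
    subgoal using n st by algebra
    subgoal using n st by algebra
    subgoal using n st by algebra
    subgoal using n st by algebra
    subgoal using n st by algebra
    subgoal using n st by algebra
    done
  moreover have "det (rot \<xi> \<omega>) = 1"
    unfolding det_3 e using n st by algebra
  ultimately show ?thesis
    by (simp add: SO3_def rotation_matrix_def orthogonal_matrix)
qed

lemma measurable_id_restrict_lborel: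
  "(\<lambda>x. x) \<in> restrict_space lborel S \<rightarrow>\<^sub>M (borel :: real measure)"
  by (rule measurable_restrict_space1) simp

lemma measurable_id_sphere_measure: "(\<lambda>x. x) \<in> sphere_measure \<rightarrow>\<^sub>M borel"
  unfolding sphere_measure_def measurable_distr_eq1 by (rule measurable_restrict_space1) simp

lemma continuous_sph: "continuous_on UNIV sph"
proof -
  have "sph = (\<lambda>p. \<chi> i. if i = 1 then cos (fst p) * sin (snd p)
                   else if i = 2 then sin (fst p) * sin (snd p) else cos (snd p))"
    by (auto simp: sph_def fun_eq_iff vec_eq_iff forall_3)
  moreover have "continuous_on UNIV \<dots>"
  proof (rule continuous_on_vec_lambda)
    fix i :: 3
    show "continuous_on UNIV (\<lambda>p::real \<times> real. if i = 1 then cos (fst p) * sin (snd p)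
        else if i = 2 then sin (fst p) * sin (snd p) else cos (snd p))"
      by (cases "i = 1"; cases "i = 2") (auto intro!: continuous_intros)
  qed
  ultimately show ?thesis by (simp only:)
qed

lemma rot_component:
  "rot n \<omega> $ i $ j = (1 - cos \<omega>) * (n $ i * n $ j) + cos \<omega> * mat 1 $ i $ j
     + sin \<omega> * (n \<bullet> cross3 (axis j 1) (axis i 1))"
  by (simp add: rot_def matrix_def) (metis cross_triple inner_commute inner_axis inner_real_def mult_1_right)

lemma continuous_rot: "continuous_on UNIV (\<lambda>p::real \<times> (real^3). rot (snd p) (fst p))"
proof -
  have "continuous_on UNIV (\<lambda>p::real \<times> (real^3). \<chi> i j. rot (snd p) (fst p) $ i $ j)"
    unfolding rot_component
    by (intro continuous_on_vec_lambda) (intro continuous_intros)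
  then show ?thesis by simp
qed

lemma measurable_sph:
  "sph \<in> restrict_space lborel {0..2*pi} \<Otimes>\<^sub>M angles \<rightarrow>\<^sub>M restrict_space borel (sphere 0 1)"
proof (rule measurable_restrict_space2)
  have "sph \<in> borel_measurable borel"
    using continuous_sph by (rule borel_measurable_continuous_onI)
  then have "sph \<in> borel \<Otimes>\<^sub>M borel \<rightarrow>\<^sub>M borel"
    by (simp add: borel_prod)
  moreover have "(\<lambda>p. p) \<in> restrict_space lborel {0..2*pi} \<Otimes>\<^sub>M angles \<rightarrow>\<^sub>M borel \<Otimes>\<^sub>M borel"
    unfolding angles_def
    by (intro measurable_Pair[where f=fst and g=snd, simplified]
        measurable_compose[OF measurable_fst measurable_id_restrict_lborel]
        measurable_compose[OF measurable_snd measurable_id_restrict_lborel])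
  ultimately show "sph \<in> restrict_space lborel {0..2*pi} \<Otimes>\<^sub>M angles \<rightarrow>\<^sub>M borel"
    by simp
qed (use sph_in_sphere in auto)

lemma measurable_rot:
  "(\<lambda>(\<omega>, \<xi>). rot \<xi> \<omega>) \<in> angles \<Otimes>\<^sub>M sphere_measure \<rightarrow>\<^sub>M restrict_space borel SO3"
proof (rule measurable_restrict_space2)
  have "(\<lambda>p::real \<times> (real^3). rot (snd p) (fst p)) \<in> borel_measurable borel"
    using continuous_rot by (rule borel_measurable_continuous_onI)
  then have "(\<lambda>p::real \<times> (real^3). rot (snd p) (fst p)) \<in> borel \<Otimes>\<^sub>M borel \<rightarrow>\<^sub>M borel"
    by (simp add: borel_prod)
  moreover have "(\<lambda>p. p) \<in> angles \<Otimes>\<^sub>M sphere_measure \<rightarrow>\<^sub>M borel \<Otimes>\<^sub>M borel"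
    unfolding angles_def
    by (intro measurable_Pair[where f=fst and g=snd, simplified]
        measurable_compose[OF measurable_fst measurable_id_restrict_lborel]
        measurable_compose[OF measurable_snd measurable_id_sphere_measure])
  ultimately show "(\<lambda>(\<omega>, \<xi>). rot \<xi> \<omega>) \<in> angles \<Otimes>\<^sub>M sphere_measure \<rightarrow>\<^sub>M borel"
    by (simp add: case_prod_unfold)
qed (auto simp: space_pair_measure sphere_measure_def space_restrict_space intro: rot_in_SO3)

lemma sigma_finite_angles: "sigma_finite_measure angles"
  unfolding angles_def by (rule sigma_finite_measure_restrict_space) (auto intro: lborel.sigma_finite_measure_axioms)

lemma nn_integral_sphere_measure:
  assumes "f \<in> borel_measurable (restrict_space borel (sphere 0 1))"
  shows "(\<integral>\<^sup>+\<xi>. f \<xi> \<partial>sphere_measure) =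
    (\<integral>\<^sup>+\<phi>\<in>{0..2*pi}. (\<integral>\<^sup>+\<theta>\<in>{0..pi}. ennreal (sin \<theta>) * f (sph (\<phi>, \<theta>)) \<partial>lborel) \<partial>lborel)"
proof -
  interpret sigma_finite_measure angles by (rule sigma_finite_angles)
  let ?N = "restrict_space lborel {0..2*pi} \<Otimes>\<^sub>M angles"
  have [measurable]: "(\<lambda>p. ennreal (sin (snd p))) \<in> borel_measurable ?N"
    unfolding angles_def
    by (rule measurable_compose[OF measurable_compose[OF measurable_snd measurable_id_restrict_lborel]])
      measurable
  have [measurable]: "(\<lambda>p. f (sph p)) \<in> borel_measurable ?N"
    using measurable_compose[OF measurable_sph assms] .
  have "(\<integral>\<^sup>+\<xi>. f \<xi> \<partial>sphere_measure) = (\<integral>\<^sup>+p. f (sph p) \<partial>density ?N (\<lambda>p. ennreal (sin (snd p))))"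
    unfolding sphere_measure_def case_prod_unfold
    by (rule nn_integral_distr) (use measurable_sph assms in auto)
  also have "\<dots> = (\<integral>\<^sup>+p. ennreal (sin (snd p)) * f (sph p) \<partial>?N)"
    by (rule nn_integral_density) measurable
  also have "\<dots> = (\<integral>\<^sup>+\<phi>. \<integral>\<^sup>+\<theta>. ennreal (sin \<theta>) * f (sph (\<phi>, \<theta>)) \<partial>angles \<partial>restrict_space lborel {0..2*pi})"
    by (subst nn_integral_fst[symmetric]) auto
  also have "\<dots> = (\<integral>\<^sup>+\<phi>\<in>{0..2*pi}. (\<integral>\<^sup>+\<theta>\<in>{0..pi}. ennreal (sin \<theta>) * f (sph (\<phi>, \<theta>)) \<partial>lborel) \<partial>lborel)"
    by (simp add: angles_def nn_integral_restrict_space)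
  finally show ?thesis .
qed

lemma emeasure_sphere_measure: "emeasure sphere_measure (sphere 0 1) = ennreal (4 * pi)"
proof -
  have "(\<integral>\<^sup>+\<theta>\<in>{0..pi}. ennreal (sin \<theta>) \<partial>lborel) = ennreal (- cos pi - (- cos 0))"
    by (rule nn_integral_FTC_Icc) (auto intro!: derivative_eq_intros sin_ge_zero)
  then have "(\<integral>\<^sup>+\<theta>\<in>{0..pi}. ennreal (sin \<theta>) \<partial>lborel) = 2"
    by simp
  moreover have "emeasure sphere_measure (sphere 0 1) = (\<integral>\<^sup>+\<xi>. 1 \<partial>sphere_measure)"
    by (simp add: sphere_measure_def space_restrict_space)
  ultimately have "emeasure sphere_measure (sphere 0 1) = 2 * ennreal (2 * pi)"
    by (subst (asm) nn_integral_sphere_measure) (auto simp: nn_integral_cmult_indicator)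
  then show ?thesis
    by (simp flip: ennreal_mult' ennreal_numeral)
qed

lemma nn_integral_SO3_measure:
  assumes "f \<in> borel_measurable (restrict_space borel SO3)"
  shows "(\<integral>\<^sup>+Q. f Q \<partial>SO3_measure) =
    2 * (\<integral>\<^sup>+\<omega>\<in>{0..pi}. (\<integral>\<^sup>+\<xi>. f (rot \<xi> \<omega>) * ennreal (1 - cos \<omega>) \<partial>sphere_measure) \<partial>lborel)"
proof -
  have "finite_measure sphere_measure"
    using emeasure_sphere_measure
    by (intro finite_measureI) (simp add: sphere_measure_def space_restrict_space)
  then interpret finite_measure sphere_measure .
  let ?N = "angles \<Otimes>\<^sub>M sphere_measure"
  have [measurable]: "(\<lambda>p. ennreal (1 - cos (fst p))) \<in> borel_measurable ?N"
    unfolding angles_def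
    by (rule measurable_compose[OF measurable_compose[OF measurable_fst measurable_id_restrict_lborel]])
      measurable
  have [measurable]: "(\<lambda>p. f (rot (snd p) (fst p))) \<in> borel_measurable ?N"
    using measurable_compose[OF measurable_rot assms] by (simp add: case_prod_unfold)
  have d: "ennreal (2 * (1 - cos \<omega>)) = 2 * ennreal (1 - cos \<omega>)" for \<omega>
    by (subst ennreal_mult) auto
  have "(\<integral>\<^sup>+Q. f Q \<partial>SO3_measure) =
      (\<integral>\<^sup>+p. f (rot (snd p) (fst p)) \<partial>density ?N (\<lambda>p. 2 * ennreal (1 - cos (fst p))))"
    unfolding SO3_measure_def case_prod_unfold d
    by (rule nn_integral_distr) (use measurable_rot assms in \<open>auto simp: case_prod_unfold\<close>)
  also have "\<dots> = (\<integral>\<^sup>+p. 2 * ennreal (1 - cos (fst p)) * f (rot (snd p) (fst p)) \<partial>?N)"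
    by (rule nn_integral_density) measurable
  also have "\<dots> = (\<integral>\<^sup>+p. 2 * (f (rot (snd p) (fst p)) * ennreal (1 - cos (fst p))) \<partial>?N)"
    by (simp add: ac_simps)
  also have "\<dots> = 2 * (\<integral>\<^sup>+p. f (rot (snd p) (fst p)) * ennreal (1 - cos (fst p)) \<partial>?N)"
    by (rule nn_integral_cmult) measurable
  also have "\<dots> = 2 * (\<integral>\<^sup>+\<omega>. \<integral>\<^sup>+\<xi>. f (rot \<xi> \<omega>) * ennreal (1 - cos \<omega>) \<partial>sphere_measure \<partial>angles)"
    by (subst nn_integral_fst[symmetric]) auto
  finally show ?thesis
    by (simp add: angles_def nn_integral_restrict_space)
qed

lemma emeasure_SO3_measure: "emeasure SO3_measure SO3 = ennreal (8 * pi\<^sup>2)"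
proof -
  have sp: "space sphere_measure = sphere 0 1"
    by (simp add: sphere_measure_def space_restrict_space)
  have "(\<integral>\<^sup>+\<omega>\<in>{0..pi}. ennreal (1 - cos \<omega>) \<partial>lborel) = ennreal ((pi - sin pi) - (0 - sin 0))"
    by (rule nn_integral_FTC_Icc) (auto intro!: derivative_eq_intros)
  then have i: "(\<integral>\<^sup>+\<omega>\<in>{0..pi}. ennreal (1 - cos \<omega>) \<partial>lborel) = ennreal pi"
    by simp
  have "emeasure SO3_measure SO3 = (\<integral>\<^sup>+Q. 1 \<partial>SO3_measure)"
    by (simp add: SO3_measure_def space_restrict_space)
  also have "\<dots> = 2 * (\<integral>\<^sup>+\<omega>\<in>{0..pi}. (ennreal (1 - cos \<omega>) * ennreal (4 * pi)) \<partial>lborel)"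
    by (subst nn_integral_SO3_measure) (simp_all add: sp emeasure_sphere_measure)
  also have "\<dots> = 2 * (\<integral>\<^sup>+\<omega>. (ennreal (1 - cos \<omega>) * indicator {0..pi} \<omega>) * ennreal (4 * pi) \<partial>lborel)"
    by (simp add: ac_simps)
  also have "\<dots> = 2 * (ennreal pi * ennreal (4 * pi))"
    using i by (subst nn_integral_multc) auto
  also have "\<dots> = ennreal (8 * pi\<^sup>2)"
    by (simp add: power2_eq_square flip: ennreal_mult' ennreal_numeral)
  finally show ?thesis .
qed

end

theory Submission
  imports Defs
begin

text \<open>
  Both adjoint formulas come from the invariance of the measure on \<open>SO(3)\<close> under left
  translations. The axis-angle formula writes \<open>\<integral> h(A) d\<sigma>(A)\<close> as the integral of
  \<open>2 (1 - cos \<omega>) \<integral> h(R\<^sub>\<xi>(\<omega>)) d\<xi>\<close> over \<open>\<omega>\<close>. For \<open>h(A) = f(QA) cnj (g(\<angle>(A)))\<close>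
  the second factor equals \<open>cnj (g(\<omega>))\<close> on the whole sphere of rotations of angle \<open>\<omega>\<close>, and
  what remains is \<open>\<langle>\<T>\<^sub>Q f, g\<rangle>\<close>. Left invariance replaces \<open>A\<close> by \<open>Q\<^sup>T A\<close>, which turns \<open>f(QA)\<close>
  into \<open>f(A)\<close> and \<open>\<angle>(A)\<close> into \<open>d\<^sub>Q(A)\<close>; this is \<open>radon_at_adjoint\<close>. Boundedness with
  \<open>16\<pi>\<close> as the bound for the squared norm follows from the Cauchy-Schwarz inequality on each
  sphere together with \<open>2 (1 - cos \<omega>) \<le> 4\<close>. The transform in both variables is, for each \<open>Q\<close>, a
  multiple of \<open>\<T>\<^sub>Q\<close>, so integrating the first adjoint formula over \<open>Q\<close> and exchanging the order
  of integration gives the second one (\<open>radon_adjoint\<close>).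
  
  The measure is given only by its axis-angle formula, and left translations are not
  visible in these coordinates, so invariance needs an argument of its own. It is obtained
  from the quaternions. A nonzero quaternion \<open>q\<close> acts on the imaginary quaternions by
  conjugation, and this is a rotation \<open>nrot q\<close>; with \<open>q = \<rho> (cos \<psi> + sin \<psi> \<xi>)\<close> it is the rotation about
  \<open>\<xi>\<close> by the angle \<open>2\<psi>\<close>. Spherical coordinates of \<open>\<real>\<^sup>4\<close> have volume element
  \<open>\<rho>\<^sup>3 sin\<^sup>2 \<psi> d\<rho> d\<psi> d\<xi>\<close>, and \<open>2 sin\<^sup>2 \<psi> = 1 - cos (2\<psi>)\<close>, so the axis-angle measure is a multiple
  of the image of Lebesgue measure on the unit ball under \<open>nrot\<close> (\<open>nn_integral_nrot_ball\<close>).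
  Every rotation is \<open>nrot a\<close> for some unit quaternion \<open>a\<close> (\<open>nrot_onto\<close>), \<open>nrot\<close> is multiplicative,
  and multiplication by \<open>a\<close> is an isometry of \<open>\<real>\<^sup>4\<close>, which preserves both the ball and
  Lebesgue measure. The spherical coordinates are built up by three applications of
  polar coordinates in a plane or a half-plane.
\<close>

section \<open>Polar coordinates in the plane\<close>

text \<open>
  Substitution on the compact intervals \<open>[-n, n]\<close>, whose images under \<open>arctan\<close> exhaust the
  open interval.
\<close>

lemma nn_integral_arctan:
  fixes f :: "real \<Rightarrow> ennreal"
  assumes [measurable]: "f \<in> borel_measurable borel"
  shows "(\<integral>\<^sup>+\<alpha>\<in>{-pi/2<..<pi/2}. f \<alpha> \<partial>lborel)
       = (\<integral>\<^sup>+u. f (arctan u) * ennreal (1 / (1 + u\<^sup>2)) \<partial>lborel)"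
proof -
  define \<nu> where "\<nu> = density lborel f"
  define \<nu>' where "\<nu>' = density lborel (\<lambda>u. f (arctan u) * ennreal (1 / (1 + u\<^sup>2)))"
  define A where "A = (\<lambda>n::nat. {arctan (- real (Suc n))..arctan (real (Suc n))})"
  define B where "B = (\<lambda>n::nat. {- real (Suc n)..real (Suc n)})"
  have AB: "emeasure \<nu> (A n) = emeasure \<nu>' (B n)" for n
    unfolding \<nu>_def \<nu>'_def A_def B_def
    apply (subst emeasure_density, simp, simp)
    apply (subst emeasure_density, simp, simp)
    apply (rule nn_integral_substitution_aux)
    by (auto intro!: derivative_eq_intros continuous_intros simp: inverse_eq_divide add_nonneg_eq_0_iff)
  have "{-pi/2<..<pi/2} = (\<Union>n. A n)"
  proof (intro set_eqI iffI)
    fix \<alpha> assume a: "\<alpha> \<in> {-pi/2<..<pi/2}"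
    then have at: "arctan (tan \<alpha>) = \<alpha>" by (intro arctan_tan) auto
    obtain n where n: "\<bar>tan \<alpha>\<bar> \<le> real n" using real_arch_simple by blast
    have "arctan (- real (Suc n)) \<le> arctan (tan \<alpha>)" "arctan (tan \<alpha>) \<le> arctan (real (Suc n))"
      using n by (auto simp only: arctan_le_iff)
    then show "\<alpha> \<in> (\<Union>n. A n)"
      by (auto simp: A_def at intro: exI[of _ n])
  next
    fix \<alpha> assume "\<alpha> \<in> (\<Union>n. A n)"
    then obtain n where "arctan (- real (Suc n)) \<le> \<alpha>" "\<alpha> \<le> arctan (real (Suc n))"
      by (auto simp: A_def)
    then show "\<alpha> \<in> {-pi/2<..<pi/2}"
      using arctan_lbound[of "- real (Suc n)"] arctan_ubound[of "real (Suc n)"] 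
      by (simp del: of_nat_Suc)
  qed
  moreover have "UNIV = (\<Union>n. B n)"
  proof -
    have "\<exists>n. x \<in> B n" for x
    proof -
      obtain n where "\<bar>x\<bar> \<le> real n" using real_arch_simple by blast
      then show ?thesis by (intro exI[of _ n]) (auto simp: B_def)
    qed
    then show ?thesis by auto
  qed
  moreover have "(SUP n. emeasure \<nu> (A n)) = emeasure \<nu> (\<Union>n. A n)"
    by (intro SUP_emeasure_incseq) (auto simp: \<nu>_def A_def incseq_def arctan_le_iff intro: order_trans)
  moreover have "(SUP n. emeasure \<nu>' (B n)) = emeasure \<nu>' (\<Union>n. B n)"
    by (intro SUP_emeasure_incseq) (auto simp: \<nu>'_def B_def incseq_def)
  ultimately have "emeasure \<nu> {-pi/2<..<pi/2} = emeasure \<nu>' UNIV"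
    by (simp add: AB)
  then show ?thesis
    by (simp add: \<nu>_def \<nu>'_def emeasure_density)
qed

lemma nn_integral_lborel_swap:
  fixes F :: "real \<Rightarrow> real \<Rightarrow> ennreal"
  assumes "(\<lambda>(x, y). F x y) \<in> borel_measurable (borel \<Otimes>\<^sub>M borel)"
  shows "(\<integral>\<^sup>+x. \<integral>\<^sup>+y. F x y \<partial>lborel \<partial>lborel) = (\<integral>\<^sup>+y. \<integral>\<^sup>+x. F x y \<partial>lborel \<partial>lborel)"
proof -
  show ?thesis
    using lborel_pair.Fubini[of "\<lambda>(x, y). F x y"] assms by simp
qed

lemma nn_integral_lborel_set_swap:
  fixes F :: "real \<Rightarrow> real \<Rightarrow> ennreal"
  assumes F: "(\<lambda>(x, y). F x y) \<in> borel_measurable (borel \<Otimes>\<^sub>M borel)"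
    and [measurable]: "B \<in> sets borel"
  shows "(\<integral>\<^sup>+x. (\<integral>\<^sup>+y\<in>B. F x y \<partial>lborel) \<partial>lborel) = (\<integral>\<^sup>+y\<in>B. (\<integral>\<^sup>+x. F x y \<partial>lborel) \<partial>lborel)"
proof -
  have [measurable (raw)]: "(\<lambda>x. F (g x) (h x)) \<in> borel_measurable N"
    if "g \<in> borel_measurable N" "h \<in> borel_measurable N" for g h and N :: "'z measure"
    using measurable_compose[OF measurable_Pair[OF that] F] by simp
  have "(\<integral>\<^sup>+x. (\<integral>\<^sup>+y\<in>B. F x y \<partial>lborel) \<partial>lborel) = (\<integral>\<^sup>+y. \<integral>\<^sup>+x. F x y * indicator B y \<partial>lborel \<partial>lborel)"
    by (rule nn_integral_lborel_swap) measurable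
  also have "\<dots> = (\<integral>\<^sup>+y\<in>B. (\<integral>\<^sup>+x. F x y \<partial>lborel) \<partial>lborel)"
    by (intro nn_integral_cong nn_integral_multc) measurable
  finally show ?thesis .
qed

lemma nn_integral_set_cong:
  assumes "\<And>x. x \<in> A \<Longrightarrow> f x = g x"
  shows "(\<integral>\<^sup>+x\<in>A. f x \<partial>M) = (\<integral>\<^sup>+x\<in>A. g x \<partial>M)"
  using assms by (intro nn_integral_cong) (auto simp: indicator_def)

text \<open>
  The change of variables is split into one-dimensional ones. Slopes \<open>u = t / s\<close> replace \<open>t\<close>,
  then for a fixed slope the distance \<open>\<rho> = s \<surd>(1 + u\<^sup>2)\<close> replaces \<open>s\<close>, which leaves the density
  \<open>\<rho> / (1 + u\<^sup>2)\<close>; finally \<open>u = cot \<psi>\<close>, handled as \<open>u = tan \<alpha>\<close> with \<open>\<psi> = \<pi>/2 - \<alpha>\<close>.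
\<close>

lemma nn_integral_polar_half_plane:
  fixes F :: "real \<Rightarrow> real \<Rightarrow> ennreal"
  assumes F: "(\<lambda>(t, s). F t s) \<in> borel_measurable (borel \<Otimes>\<^sub>M borel)"
  shows "(\<integral>\<^sup>+t. (\<integral>\<^sup>+s\<in>{0<..}. F t s \<partial>lborel) \<partial>lborel)
       = (\<integral>\<^sup>+\<psi>\<in>{0..pi}. (\<integral>\<^sup>+\<rho>\<in>{0<..}. ennreal \<rho> * F (\<rho> * cos \<psi>) (\<rho> * sin \<psi>) \<partial>lborel) \<partial>lborel)"
proof -
  have [measurable (raw)]: "(\<lambda>x. F (g x) (h x)) \<in> borel_measurable N"
    if "g \<in> borel_measurable N" "h \<in> borel_measurable N" for g h and N :: "'z measure"
    using measurable_compose[OF measurable_Pair[OF that] F] by simp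
  define H where "H = (\<lambda>\<alpha>. (\<integral>\<^sup>+\<rho>\<in>{0<..}. ennreal \<rho> * F (\<rho> * sin \<alpha>) (\<rho> * cos \<alpha>) \<partial>lborel))"
  have [measurable]: "H \<in> borel_measurable borel"
    unfolding H_def by measurable
  have "(\<integral>\<^sup>+t. (\<integral>\<^sup>+s\<in>{0<..}. F t s \<partial>lborel) \<partial>lborel)
      = (\<integral>\<^sup>+s. \<integral>\<^sup>+t. F t s * indicator {0<..} s \<partial>lborel \<partial>lborel)"
    by (rule nn_integral_lborel_swap) measurable
  also have "\<dots> = (\<integral>\<^sup>+s. \<integral>\<^sup>+u. ennreal s * F (s * u) s * indicator {0<..} s \<partial>lborel \<partial>lborel)"
  proof (rule nn_integral_cong)
    fix s :: real
    show "(\<integral>\<^sup>+t. F t s * indicator {0<..} s \<partial>lborel)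
        = (\<integral>\<^sup>+u. ennreal s * F (s * u) s * indicator {0<..} s \<partial>lborel)"
    proof (cases "s > 0")
      case True
      then show ?thesis
        by (subst nn_integral_real_affine[where c = s and t = 0])
          (auto simp: mult.assoc nn_integral_cmult)
    qed simp
  qed
  also have "\<dots> = (\<integral>\<^sup>+u. (\<integral>\<^sup>+s\<in>{0<..}. ennreal s * F (s * u) s \<partial>lborel) \<partial>lborel)"
    by (rule nn_integral_lborel_swap) measurable
  also have "\<dots> = (\<integral>\<^sup>+u. H (arctan u) * ennreal (1 / (1 + u\<^sup>2)) \<partial>lborel)"
  proof (rule nn_integral_cong)
    fix u :: real
    (* s = c * \<rho> when \<rho> is the distance from the origin along the line of slope u. *)
    define c where "c = cos (arctan u)"
    have c: "c > 0" "c * u = sin (arctan u)"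
      by (auto simp: c_def cos_arctan sin_arctan add_pos_nonneg)
    have c2: "c * c = 1 / (1 + u\<^sup>2)"
      by (simp add: c_def cos_arctan add_nonneg_nonneg)
    have "(\<integral>\<^sup>+s\<in>{0<..}. ennreal s * F (s * u) s \<partial>lborel)
       = ennreal c * (\<integral>\<^sup>+\<rho>. ennreal (c * \<rho>) * F (c * \<rho> * u) (c * \<rho>) * indicator {0<..} (c * \<rho>) \<partial>lborel)"
      using c(1) by (subst nn_integral_real_affine[where c = c and t = 0]) auto
    also have "\<dots> = (\<integral>\<^sup>+\<rho>. (ennreal \<rho> * F (\<rho> * sin (arctan u)) (\<rho> * cos (arctan u)) * indicator {0<..} \<rho>)
        * ennreal (1 / (1 + u\<^sup>2)) \<partial>lborel)"
    proof (subst nn_integral_cmult[symmetric], measurable, rule nn_integral_cong)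
      fix \<rho> :: real
      have i: "indicator {0<..} (c * \<rho>) = (indicator {0<..} \<rho> :: ennreal)"
        using c(1) by (auto simp: indicator_def zero_less_mult_iff)
      have "c * \<rho> * u = \<rho> * sin (arctan u)" "c * \<rho> = \<rho> * cos (arctan u)"
        using c(2) by (simp_all add: c_def)
      then have X: "F (c * \<rho> * u) (c * \<rho>) = F (\<rho> * sin (arctan u)) (\<rho> * cos (arctan u))" (is "?X = ?Y")
        by (simp only:)
      have "ennreal c * ennreal (c * \<rho>) = ennreal \<rho> * ennreal (1 / (1 + u\<^sup>2))" if "\<rho> > 0"
        using c(1) that by (simp add: c2[symmetric] flip: ennreal_mult)
      then have "(ennreal c * ennreal (c * \<rho>)) * (?X * indicator {0<..} (c * \<rho>))
          = (ennreal \<rho> * ennreal (1 / (1 + u\<^sup>2))) * (?Y * indicator {0<..} \<rho>)"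
        unfolding i X by (cases "\<rho> > 0") auto
      then show "ennreal c * (ennreal (c * \<rho>) * ?X * indicator {0<..} (c * \<rho>))
        = (ennreal \<rho> * ?Y * indicator {0<..} \<rho>) * ennreal (1 / (1 + u\<^sup>2))"
        by (simp only: mult.assoc mult.commute mult.left_commute)
    qed
    also have "\<dots> = H (arctan u) * ennreal (1 / (1 + u\<^sup>2))"
      unfolding H_def by (rule nn_integral_multc) measurable
    finally show "(\<integral>\<^sup>+s\<in>{0<..}. ennreal s * F (s * u) s \<partial>lborel)
        = H (arctan u) * ennreal (1 / (1 + u\<^sup>2))" .
  qed
  also have "\<dots> = (\<integral>\<^sup>+\<alpha>. H \<alpha> * indicator {-pi/2<..<pi/2} \<alpha> \<partial>lborel)"
    by (rule nn_integral_arctan[symmetric]) measurable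
  also have "\<dots> = (\<integral>\<^sup>+\<psi>. H (pi/2 - \<psi>) * indicator {-pi/2<..<pi/2} (pi/2 - \<psi>) \<partial>lborel)"
    by (subst nn_integral_real_affine[where c = "-1" and t = "pi/2"]) auto
  also have "\<dots> = (\<integral>\<^sup>+\<psi>. H (pi/2 - \<psi>) * indicator {0..pi} \<psi> \<partial>lborel)"
  proof (rule nn_integral_cong_AE)
    have "AE \<psi> in lborel. \<psi> \<noteq> 0 \<and> \<psi> \<noteq> pi"
      using AE_lborel_singleton[of "0::real"] AE_lborel_singleton[of pi] by eventually_elim auto
    then show "AE \<psi> in lborel. H (pi/2 - \<psi>) * indicator {-pi/2<..<pi/2} (pi/2 - \<psi>)
        = H (pi/2 - \<psi>) * indicator {0..pi} \<psi>"
      by eventually_elim (auto simp: indicator_def)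
  qed
  also have "\<dots> = (\<integral>\<^sup>+\<psi>\<in>{0..pi}. (\<integral>\<^sup>+\<rho>\<in>{0<..}. ennreal \<rho> * F (\<rho> * cos \<psi>) (\<rho> * sin \<psi>) \<partial>lborel) \<partial>lborel)"
    by (simp add: H_def sin_diff cos_diff)
  finally show ?thesis .
qed

lemma nn_integral_reflect_halves:
  fixes G :: "real \<Rightarrow> ennreal"
  assumes [measurable]: "G \<in> borel_measurable borel"
  shows "(\<integral>\<^sup>+y. G y \<partial>lborel)
       = (\<integral>\<^sup>+y\<in>{0<..}. G y \<partial>lborel) + (\<integral>\<^sup>+y\<in>{0<..}. G (- y) \<partial>lborel)"
proof -
  have "(\<integral>\<^sup>+y. G y \<partial>lborel) = (\<integral>\<^sup>+y. G y * indicator {0<..} y + G y * indicator {0<..} (- y) \<partial>lborel)"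
  proof (rule nn_integral_cong_AE)
    show "AE y in lborel. G y = G y * indicator {0<..} y + G y * indicator {0<..} (- y)"
      using AE_lborel_singleton[of "0::real"] by eventually_elim (auto simp: indicator_def)
  qed
  also have "\<dots> = (\<integral>\<^sup>+y\<in>{0<..}. G y \<partial>lborel) + (\<integral>\<^sup>+y. G y * indicator {0<..} (- y) \<partial>lborel)"
    by (rule nn_integral_add) measurable
  also have "(\<integral>\<^sup>+y. G y * indicator {0<..} (- y) \<partial>lborel) = (\<integral>\<^sup>+y\<in>{0<..}. G (- y) \<partial>lborel)"
    by (subst nn_integral_real_affine[where c = "-1" and t = 0]) auto
  finally show ?thesis .
qed

lemma nn_integral_polar_plane:
  fixes F :: "real \<Rightarrow> real \<Rightarrow> ennreal"
  assumes F: "(\<lambda>(x, y). F x y) \<in> borel_measurable (borel \<Otimes>\<^sub>M borel)"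
  shows "(\<integral>\<^sup>+x. \<integral>\<^sup>+y. F x y \<partial>lborel \<partial>lborel)
       = (\<integral>\<^sup>+\<phi>\<in>{0..2*pi}. (\<integral>\<^sup>+p\<in>{0<..}. ennreal p * F (p * cos \<phi>) (p * sin \<phi>) \<partial>lborel) \<partial>lborel)"
proof -
  have [measurable (raw)]: "(\<lambda>x. F (g x) (h x)) \<in> borel_measurable N"
    if "g \<in> borel_measurable N" "h \<in> borel_measurable N" for g h and N :: "'z measure"
    using measurable_compose[OF measurable_Pair[OF that] F] by simp
  define H where "H = (\<lambda>\<phi>. (\<integral>\<^sup>+p\<in>{0<..}. ennreal p * F (p * cos \<phi>) (p * sin \<phi>) \<partial>lborel))"
  have [measurable]: "H \<in> borel_measurable borel"
    unfolding H_def by measurable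
  have "(\<integral>\<^sup>+x. \<integral>\<^sup>+y. F x y \<partial>lborel \<partial>lborel)
      = (\<integral>\<^sup>+x. (\<integral>\<^sup>+y\<in>{0<..}. F x y \<partial>lborel) + (\<integral>\<^sup>+y\<in>{0<..}. F x (- y) \<partial>lborel) \<partial>lborel)"
    by (intro nn_integral_cong nn_integral_reflect_halves) measurable
  also have "\<dots> = (\<integral>\<^sup>+x. (\<integral>\<^sup>+y\<in>{0<..}. F x y \<partial>lborel) \<partial>lborel)
      + (\<integral>\<^sup>+x. (\<integral>\<^sup>+y\<in>{0<..}. F x (- y) \<partial>lborel) \<partial>lborel)"
    by (rule nn_integral_add) measurable
  also have "(\<integral>\<^sup>+x. (\<integral>\<^sup>+y\<in>{0<..}. F x y \<partial>lborel) \<partial>lborel) = (\<integral>\<^sup>+\<phi>\<in>{0..pi}. H \<phi> \<partial>lborel)"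
    unfolding H_def by (rule nn_integral_polar_half_plane) measurable
  also have "(\<integral>\<^sup>+x. (\<integral>\<^sup>+y\<in>{0<..}. F x (- y) \<partial>lborel) \<partial>lborel) = (\<integral>\<^sup>+\<phi>\<in>{0..pi}. H (2*pi - \<phi>) \<partial>lborel)"
  proof -
    have "cos (2*pi - \<phi>) = cos \<phi>" "sin (2*pi - \<phi>) = - sin \<phi>" for \<phi>
      by (simp_all add: sin_diff cos_diff)
    moreover have "(\<lambda>(x, y). F x (- y)) \<in> borel_measurable (borel \<Otimes>\<^sub>M borel)"
      unfolding case_prod_unfold by measurable
    ultimately show ?thesis
      by (simp add: H_def nn_integral_polar_half_plane)
  qed
  also have "\<dots> = (\<integral>\<^sup>+\<phi>. H \<phi> * indicator {0..pi} (2*pi - \<phi>) \<partial>lborel)"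
    by (subst nn_integral_real_affine[where c = "-1" and t = "2*pi"]) auto
  also have "(\<integral>\<^sup>+\<phi>\<in>{0..pi}. H \<phi> \<partial>lborel) + \<dots>
      = (\<integral>\<^sup>+\<phi>. H \<phi> * indicator {0..pi} \<phi> + H \<phi> * indicator {0..pi} (2*pi - \<phi>) \<partial>lborel)"
    by (rule nn_integral_add[symmetric]) measurable
  also have "\<dots> = (\<integral>\<^sup>+\<phi>\<in>{0..2*pi}. H \<phi> \<partial>lborel)"
  proof (rule nn_integral_cong_AE)
    show "AE \<phi> in lborel. H \<phi> * indicator {0..pi} \<phi> + H \<phi> * indicator {0..pi} (2*pi - \<phi>)
        = H \<phi> * indicator {0..2*pi} \<phi>"
      using AE_lborel_singleton[of pi] by eventually_elim (auto simp: indicator_def)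
  qed
  finally show ?thesis by (simp add: H_def)
qed

section \<open>Lebesgue measure on the quaternions\<close>

text \<open>
  On boxes this is the invariance of Lebesgue measure of sets under orthogonal
  maps, applied to the inverse map; the boxes determine the measure.
\<close>

lemma lborel_distr_orthogonal_transformation:
  fixes L :: "real^'n::{finite,wellorder} \<Rightarrow> real^'n::_"
  assumes L: "orthogonal_transformation L"
  shows "distr lborel borel L = lborel"
proof (rule lborel_eqI[symmetric])
  have [measurable]: "L \<in> borel_measurable borel"
    using L by (intro borel_measurable_continuous_onI linear_continuous_on)
      (simp add: linear_conv_bounded_linear[symmetric] orthogonal_transformation_linear)
  fix l u :: "real^'n::_" assume le: "\<And>b. b \<in> Basis \<Longrightarrow> l \<bullet> b \<le> u \<bullet> b"
  have vi: "L -` box l u = inv L ` box l u"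
    using L by (intro bij_vimage_eq_inv_image orthogonal_transformation_bij)
  have oi: "orthogonal_transformation (inv L)"
    using L by (rule orthogonal_transformation_inv)
  have im: "inv L ` box l u \<in> lmeasurable"
    using oi by (rule measurable_orthogonal_image) simp
  have b: "L -` box l u \<in> sets borel"
    using measurable_sets[of L borel borel "box l u"] by simp
  have "emeasure (distr lborel borel L) (box l u) = emeasure lebesgue (L -` box l u)"
    using b by (simp add: emeasure_distr)
  also have "\<dots> = ennreal (measure lebesgue (inv L ` box l u))"
    unfolding vi by (rule emeasure_eq_measure2[OF im])
  also have "\<dots> = ennreal (measure lebesgue (box l u))"
    by (simp add: measure_orthogonal_image[OF oi])
  also have "\<dots> = (\<Prod>b\<in>Basis. (u - l) \<bullet> b)"
    using le by simp
  finally show "emeasure (distr lborel borel L) (box l u) = (\<Prod>b\<in>Basis. (u - l) \<bullet> b)" .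
qed simp

text \<open>
  The quaternion \<open>t + x i + y j + z k\<close> as a vector of \<open>\<real>\<^sup>4\<close>, so that the quaternion norm is the
  Euclidean one and multiplication by a unit quaternion is an orthogonal map.
\<close>

definition quat :: "real \<Rightarrow> real \<Rightarrow> real \<Rightarrow> real \<Rightarrow> real^4" where
  "quat t x y z = (\<chi> i. if i = 1 then t else if i = 2 then x else if i = 3 then y else z)"

lemma quat_nth [simp]:
  "quat t x y z $ 1 = t" "quat t x y z $ 2 = x" "quat t x y z $ 3 = y" "quat t x y z $ 4 = z"
  by (simp_all add: quat_def)

lemma inner_quat: "p \<bullet> q = p $ 1 * q $ 1 + p $ 2 * q $ 2 + p $ 3 * q $ 3 + p $ 4 * (q :: real^4) $ 4"
  by (simp add: inner_vec_def sum_4)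

lemma borel_measurable_quat [measurable]:
  assumes [measurable]: "f \<in> borel_measurable M" "g \<in> borel_measurable M"
    "h \<in> borel_measurable M" "k \<in> borel_measurable M"
  shows "(\<lambda>x. quat (f x) (g x) (h x) (k x)) \<in> borel_measurable M"
proof -
  have e: "quat t x y z = t *\<^sub>R axis 1 1 + x *\<^sub>R axis 2 1 + y *\<^sub>R axis 3 1 + z *\<^sub>R axis 4 1" for t x y z
    by (simp add: vec_eq_iff forall_4 axis_def)
  show ?thesis unfolding e by measurable
qed

lemma sigma_finite_lborel_pair:
  shows "sigma_finite_measure (lborel \<Otimes>\<^sub>M lborel :: (real \<times> real) measure)"
    and "sigma_finite_measure (lborel \<Otimes>\<^sub>M (lborel \<Otimes>\<^sub>M lborel) :: (real \<times> real \<times> real) measure)"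
  unfolding lborel_prod by (rule lborel.sigma_finite_measure_axioms)+

text \<open>
  The last imaginary component is put before the other two: the order of
  iterated integration below is \<open>t, z, x, y\<close>, so that the two variables of each polar change
  of coordinates are innermost once the angles found before are moved outward.
\<close>

lemma lborel_quat:
  "(lborel :: (real^4) measure)
     = distr (lborel \<Otimes>\<^sub>M (lborel \<Otimes>\<^sub>M (lborel \<Otimes>\<^sub>M lborel))) borel (\<lambda>(t, z, x, y). quat t x y z)"
proof (rule lborel_eqI)
  let ?L = "lborel :: real measure"
  let ?f = "\<lambda>(t, z, x, y). quat t x y z"
  have m: "?f \<in> borel_measurable (?L \<Otimes>\<^sub>M (?L \<Otimes>\<^sub>M (?L \<Otimes>\<^sub>M ?L)))"
    unfolding case_prod_unfold by measurable
  fix l u :: "real^4" assume le: "\<And>b. b \<in> Basis \<Longrightarrow> l \<bullet> b \<le> u \<bullet> b"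
  have le': "l $ i \<le> u $ i" for i
    using le[of "axis i 1"] by (simp add: inner_axis)
  have vi: "?f -` box l u \<inter> space (?L \<Otimes>\<^sub>M (?L \<Otimes>\<^sub>M (?L \<Otimes>\<^sub>M ?L)))
      = {l$1<..<u$1} \<times> {l$4<..<u$4} \<times> {l$2<..<u$2} \<times> {l$3<..<u$3}"
    by (auto simp: mem_box_cart forall_4 space_pair_measure)
  have "emeasure (distr (?L \<Otimes>\<^sub>M (?L \<Otimes>\<^sub>M (?L \<Otimes>\<^sub>M ?L))) borel ?f) (box l u)
      = emeasure (?L \<Otimes>\<^sub>M (?L \<Otimes>\<^sub>M (?L \<Otimes>\<^sub>M ?L)))
          ({l$1<..<u$1} \<times> {l$4<..<u$4} \<times> {l$2<..<u$2} \<times> {l$3<..<u$3})"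
    using emeasure_distr[OF m, of "box l u"] unfolding vi by simp
  also have "\<dots> = ennreal (u$1 - l$1) * (ennreal (u$4 - l$4) * (ennreal (u$2 - l$2) * ennreal (u$3 - l$3)))"
  proof -
    have s: "{a<..<b} \<in> sets ?L" for a b by simp
    have s2: "{l$2<..<u$2} \<times> {l$3<..<u$3} \<in> sets (?L \<Otimes>\<^sub>M ?L)"
      by (intro pair_measureI s)
    have s3: "{l$4<..<u$4} \<times> {l$2<..<u$2} \<times> {l$3<..<u$3} \<in> sets (?L \<Otimes>\<^sub>M (?L \<Otimes>\<^sub>M ?L))"
      by (intro pair_measureI s)
    have e: "emeasure ?L {l$i<..<u$i} = ennreal (u$i - l$i)" for i
      by (rule emeasure_lborel_Ioo) (rule le')
    show ?thesis
      unfolding sigma_finite_measure.emeasure_pair_measure_Times[OF sigma_finite_lborel_pair(2) s s3]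
        sigma_finite_measure.emeasure_pair_measure_Times[OF sigma_finite_lborel_pair(1) s s2]
        lborel.emeasure_pair_measure_Times[OF s s] e ..
  qed
  also have "\<dots> = ennreal (\<Prod>i\<in>UNIV. u$i - l$i)"
  proof -
    have p: "(\<Prod>i\<in>UNIV. u$i - l$i) = (u$1 - l$1) * ((u$4 - l$4) * ((u$2 - l$2) * (u$3 - l$3)))"
      unfolding UNIV_4 by simp
    show ?thesis
      unfolding p by (simp only: ennreal_mult mult_nonneg_nonneg diff_ge_0_iff_ge le')
  qed
  also have "(\<Prod>i\<in>UNIV. u$i - l$i) = (\<Prod>b\<in>Basis. (u - l) \<bullet> b)"
    by (simp add: Basis_vec_def prod.UNION_disjoint axis_eq_axis cart_eq_inner_axis
        prod.reindex inj_on_def inner_diff_left)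
  finally show "emeasure (distr (?L \<Otimes>\<^sub>M (?L \<Otimes>\<^sub>M (?L \<Otimes>\<^sub>M ?L))) borel ?f) (box l u)
      = ennreal (\<Prod>b\<in>Basis. (u - l) \<bullet> b)" .
qed simp

lemma nn_integral_lborel_quat:
  fixes F :: "real^4 \<Rightarrow> ennreal"
  assumes [measurable]: "F \<in> borel_measurable borel"
  shows "(\<integral>\<^sup>+q. F q \<partial>lborel) =
    (\<integral>\<^sup>+t. \<integral>\<^sup>+z. \<integral>\<^sup>+x. \<integral>\<^sup>+y. F (quat t x y z) \<partial>lborel \<partial>lborel \<partial>lborel \<partial>lborel)"
proof -
  let ?L = "lborel :: real measure"
  have "(\<integral>\<^sup>+q. F q \<partial>lborel) = (\<integral>\<^sup>+(t, z, x, y). F (quat t x y z) \<partial>(?L \<Otimes>\<^sub>M (?L \<Otimes>\<^sub>M (?L \<Otimes>\<^sub>M ?L))))"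
    unfolding case_prod_unfold
    by (subst lborel_quat) (simp add: nn_integral_distr case_prod_unfold)
  also have "\<dots> = (\<integral>\<^sup>+t. \<integral>\<^sup>+z. \<integral>\<^sup>+x. \<integral>\<^sup>+y. F (quat t x y z) \<partial>lborel \<partial>lborel \<partial>lborel \<partial>lborel)"
    by (simp add: sigma_finite_measure.nn_integral_fst[OF sigma_finite_lborel_pair(2), symmetric]
        sigma_finite_measure.nn_integral_fst[OF sigma_finite_lborel_pair(1), symmetric]
        lborel.nn_integral_fst[symmetric] case_prod_unfold)
  finally show ?thesis .
qed

section \<open>Quaternions and rotations\<close>

definition qmult :: "real^4 \<Rightarrow> real^4 \<Rightarrow> real^4" where
  "qmult a q = quat
     (a $ 1 * q $ 1 - a $ 2 * q $ 2 - a $ 3 * q $ 3 - a $ 4 * q $ 4)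
     (a $ 1 * q $ 2 + a $ 2 * q $ 1 + a $ 3 * q $ 4 - a $ 4 * q $ 3)
     (a $ 1 * q $ 3 - a $ 2 * q $ 4 + a $ 3 * q $ 1 + a $ 4 * q $ 2)
     (a $ 1 * q $ 4 + a $ 2 * q $ 3 - a $ 3 * q $ 2 + a $ 4 * q $ 1)"

text \<open>
  Euler's four-square identity.
\<close>

lemma inner_qmult: "qmult a q \<bullet> qmult a q = (a \<bullet> a) * (q \<bullet> q)"
  by (simp add: qmult_def inner_quat) algebra

lemma orthogonal_transformation_qmult:
  assumes "a \<bullet> a = 1"
  shows "orthogonal_transformation (qmult a)"
proof -
  have "linear (qmult a)"
    by (rule linearI; simp add: vec_eq_iff forall_4 qmult_def algebra_simps)
  moreover have "norm (qmult a q) = norm q" for q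
    using assms by (simp add: norm_eq_sqrt_inner inner_qmult)
  ultimately show ?thesis by (simp add: orthogonal_transformation)
qed

text \<open>
  The matrix of \<open>v \<mapsto> q v q\<^sup>*\<close> on the imaginary quaternions, for an arbitrary quaternion \<open>q\<close>; it is
  \<open>(q \<bullet> q)\<close> times a rotation.
\<close>

definition qrot :: "real^4 \<Rightarrow> real^3^3" where
  "qrot q = (let t = q $ 1; x = q $ 2; y = q $ 3; z = q $ 4 in vector [
     vector [t*t + x*x - y*y - z*z, 2 * (x*y - t*z), 2 * (x*z + t*y)],
     vector [2 * (x*y + t*z), t*t - x*x + y*y - z*z, 2 * (y*z - t*x)],
     vector [2 * (x*z - t*y), 2 * (y*z + t*x), t*t - x*x - y*y + z*z]])"

text \<open>
  Normalising the matrix rather than the quaternion keeps \<open>nrot\<close> rational, so that it is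
  multiplicative on all of \<open>\<real>\<^sup>4\<close> and invariant under nonzero scalars.
\<close>

definition nrot :: "real^4 \<Rightarrow> real^3^3" where
  "nrot q = (1 / (q \<bullet> q)) *\<^sub>R qrot q"

lemma qrot_nth:
  "qrot q $ 1 $ 1 = q$1*q$1 + q$2*q$2 - q$3*q$3 - q$4*q$4"
  "qrot q $ 1 $ 2 = 2 * (q$2*q$3 - q$1*q$4)"
  "qrot q $ 1 $ 3 = 2 * (q$2*q$4 + q$1*q$3)"
  "qrot q $ 2 $ 1 = 2 * (q$2*q$3 + q$1*q$4)"
  "qrot q $ 2 $ 2 = q$1*q$1 - q$2*q$2 + q$3*q$3 - q$4*q$4"
  "qrot q $ 2 $ 3 = 2 * (q$3*q$4 - q$1*q$2)"
  "qrot q $ 3 $ 1 = 2 * (q$2*q$4 - q$1*q$3)"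
  "qrot q $ 3 $ 2 = 2 * (q$3*q$4 + q$1*q$2)"
  "qrot q $ 3 $ 3 = q$1*q$1 - q$2*q$2 - q$3*q$3 + q$4*q$4"
  by (simp_all add: qrot_def Let_def)

lemma qrot_qmult: "qrot (qmult a q) = qrot a ** qrot q"
  unfolding vec_eq_iff forall_3 matrix_matrix_mult_def
  by (simp add: sum_3 qrot_nth qmult_def) (intro conjI; algebra)

lemma nrot_qmult: "nrot (qmult a q) = nrot a ** nrot q"
  by (simp add: nrot_def inner_qmult qrot_qmult matrix_scaleR[symmetric] scalar_matrix_assoc matrix_scalar_ac mult.commute)

lemma nrot_scaleR:
  assumes "c \<noteq> 0"
  shows "nrot (c *\<^sub>R q) = nrot q"
proof -
  have "qrot (c *\<^sub>R q) = (c * c) *\<^sub>R qrot q"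
    unfolding vec_eq_iff forall_3 by (simp add: qrot_nth algebra_simps)
  then show ?thesis using assms by (simp add: nrot_def)
qed

lemma borel_measurable_nrot [measurable]: "nrot \<in> borel_measurable borel"
proof -
  have e: "qrot = (\<lambda>q. \<Sum>i\<in>UNIV. \<Sum>j\<in>UNIV. (qrot q $ i $ j) *\<^sub>R axis i (axis j 1))"
    by (rule ext, subst vec_eq_iff) (simp add: vec_eq_iff axis_def sum_3 forall_3)
  have [measurable]: "(\<lambda>q. q $ i) \<in> borel_measurable borel" for i :: 4
    by (intro borel_measurable_continuous_onI continuous_intros)
  have "qrot \<in> borel_measurable borel"
    by (subst e) (simp add: sum_3 qrot_nth)
  then show ?thesis
    unfolding nrot_def by measurable
qed

text \<open>
  The cofactor relations say that the columns of a rotation matrix form a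
  positively oriented orthonormal frame, so that each is the cross product of the other two.
\<close>

lemma SO3_relations:
  assumes "Q \<in> SO3"
  shows SO3_rows: "Q$i$1 * Q$j$1 + Q$i$2 * Q$j$2 + Q$i$3 * Q$j$3 = (if i = j then 1 else 0)"
    and SO3_columns: "Q$1$i * Q$1$j + Q$2$i * Q$2$j + Q$3$i * Q$3$j = (if i = j then 1 else 0)"
    and SO3_cofactors:
      "Q$2$1 * Q$3$2 - Q$3$1 * Q$2$2 = Q$1$3" "Q$3$1 * Q$1$2 - Q$1$1 * Q$3$2 = Q$2$3"
      "Q$1$1 * Q$2$2 - Q$2$1 * Q$1$2 = Q$3$3" "Q$2$2 * Q$3$3 - Q$3$2 * Q$2$3 = Q$1$1"
      "Q$3$2 * Q$1$3 - Q$1$2 * Q$3$3 = Q$2$1" "Q$1$2 * Q$2$3 - Q$2$2 * Q$1$3 = Q$3$1"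
      "Q$2$3 * Q$3$1 - Q$3$3 * Q$2$1 = Q$1$2" "Q$3$3 * Q$1$1 - Q$1$3 * Q$3$1 = Q$2$2"
      "Q$1$3 * Q$2$1 - Q$2$3 * Q$1$1 = Q$3$2"
proof -
  have rm: "rotation_matrix Q" and om: "Q ** transpose Q = mat 1" "transpose Q ** Q = mat 1"
    using assms by (auto simp: SO3_def rotation_matrix_def orthogonal_matrix_def)
  have "(Q ** transpose Q) $ i $ j = mat 1 $ i $ j" "(transpose Q ** Q) $ i $ j = mat 1 $ i $ j"
    by (simp_all only: om)
  then show "Q$i$1 * Q$j$1 + Q$i$2 * Q$j$2 + Q$i$3 * Q$j$3 = (if i = j then 1 else 0)"
    "Q$1$i * Q$1$j + Q$2$i * Q$2$j + Q$3$i * Q$3$j = (if i = j then 1 else 0)"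
    by (simp_all add: matrix_matrix_mult_def transpose_def sum_3 mat_def)
  have c: "cross3 (column i Q) (column j Q) = Q *v (cross3 (axis i 1) (axis j 1))" for i j
    using cross_rotation_matrix[OF rm, of "axis i 1" "axis j 1"] by (simp add: matrix_vector_mult_basis)
  show "Q$2$1 * Q$3$2 - Q$3$1 * Q$2$2 = Q$1$3" "Q$3$1 * Q$1$2 - Q$1$1 * Q$3$2 = Q$2$3"
      "Q$1$1 * Q$2$2 - Q$2$1 * Q$1$2 = Q$3$3" "Q$2$2 * Q$3$3 - Q$3$2 * Q$2$3 = Q$1$1"
      "Q$3$2 * Q$1$3 - Q$1$2 * Q$3$3 = Q$2$1" "Q$1$2 * Q$2$3 - Q$2$2 * Q$1$3 = Q$3$1"
      "Q$2$3 * Q$3$1 - Q$3$3 * Q$2$1 = Q$1$2" "Q$3$3 * Q$1$1 - Q$1$3 * Q$3$1 = Q$2$2"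
      "Q$1$3 * Q$2$1 - Q$2$3 * Q$1$1 = Q$3$2"
    using c[of 1 2] c[of 2 3] c[of 3 1]
    by (simp_all add: vec_eq_iff forall_3 cross3_def column_def matrix_vector_mult_basis axis_def
       matrix_vector_mult_def sum_3)
qed

lemma trace_3: "trace (Q :: real^3^3) = Q$1$1 + Q$2$2 + Q$3$3"
  by (simp add: trace_def sum_3)

lemma SO3_closed_mult: "P \<in> SO3 \<Longrightarrow> Q \<in> SO3 \<Longrightarrow> P ** Q \<in> SO3"
  by (simp add: SO3_def rotation_matrix_def orthogonal_matrix_mul det_mul)

lemma SO3_transpose: "Q \<in> SO3 \<Longrightarrow> transpose Q \<in> SO3"
  by (simp add: SO3_def rotation_matrix_def)

text \<open>
  The upper bound holds since no entry exceeds 1. The lower bound follows from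
  the identity \<open>\<Sum> (Q\<^sub>i\<^sub>j - Q\<^sub>j\<^sub>i)\<^sup>2 = (1 + tr Q) (3 - tr Q)\<close>, summed over the pairs \<open>i > j\<close>, which uses
  orthogonality and that the adjugate of \<open>Q\<close> is its transpose. The bounds place the
  argument of \<open>arccos\<close> in the rotation angle in \<open>[-1, 1]\<close>.
\<close>

lemma SO3_trace_bounds:
  assumes "Q \<in> SO3"
  shows "- 1 \<le> trace Q" "trace Q \<le> 3"
proof -
  have le: "Q$i$i \<le> 1" for i
  proof -
    have "(Q$i$i)\<^sup>2 \<le> Q$i$1 * Q$i$1 + Q$i$2 * Q$i$2 + Q$i$3 * Q$i$3"
      using exhaust_3[of i] by (auto simp: power2_eq_square)
    also have "\<dots> = 1" using SO3_rows[OF assms, of i i] by simp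
    finally show ?thesis by (simp add: abs_square_le_1)
  qed
  from le[of 1] le[of 2] le[of 3] show le3: "trace Q \<le> 3" by (simp add: trace_3)
  note r = SO3_rows[OF assms, of 1 1, simplified] SO3_rows[OF assms, of 2 2, simplified]
    SO3_rows[OF assms, of 3 3, simplified]
  have "(Q$3$2 - Q$2$3)\<^sup>2 + (Q$1$3 - Q$3$1)\<^sup>2 + (Q$2$1 - Q$1$2)\<^sup>2 = (1 + trace Q) * (3 - trace Q)"
    using r SO3_cofactors[OF assms] unfolding trace_3 power2_eq_square
    by (simp add: algebra_simps)
  then have "0 \<le> (1 + trace Q) * (3 - trace Q)"
    by (metis add_nonneg_nonneg zero_le_power2)
  with le3 show "- 1 \<le> trace Q"
    by (cases "trace Q = 3") (auto simp: zero_le_mult_iff)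
qed

text \<open>
  Away from the half turns the quaternion can be read off the matrix: the
  real part is proportional to \<open>1 + tr Q\<close> and the imaginary part to the antisymmetric part of \<open>Q\<close>.
\<close>

lemma nrot_onto_of_trace:
  assumes Q: "Q \<in> SO3" and tr: "trace Q > - 1"
  shows "\<exists>a. a \<noteq> 0 \<and> nrot a = Q"
proof -
  define a where "a = quat (1 + trace Q) (Q$3$2 - Q$2$3) (Q$1$3 - Q$3$1) (Q$2$1 - Q$1$2)"
  note r = SO3_rows[OF Q, of 1 1, simplified] SO3_rows[OF Q, of 2 2, simplified]
    SO3_rows[OF Q, of 3 3, simplified] SO3_rows[OF Q, of 1 2, simplified]
    SO3_rows[OF Q, of 2 3, simplified] SO3_rows[OF Q, of 1 3, simplified]
    SO3_columns[OF Q, of 1 1, simplified] SO3_columns[OF Q, of 2 2, simplified]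
    SO3_columns[OF Q, of 3 3, simplified] SO3_columns[OF Q, of 1 2, simplified]
    SO3_columns[OF Q, of 2 3, simplified] SO3_columns[OF Q, of 1 3, simplified]
    SO3_cofactors[OF Q]
  have n: "a \<bullet> a = 4 * (1 + trace Q)"
    using r unfolding trace_3 a_def inner_quat quat_nth
    by (simp add: algebra_simps)
  have "qrot a = (4 * (1 + trace Q)) *\<^sub>R Q"
    unfolding vec_eq_iff forall_3 qrot_nth vector_scaleR_component a_def quat_nth trace_3 real_scaleR_def
    using r apply (intro conjI)
    apply (simp_all add: algebra_simps)
    done
  then have "nrot a = Q" using n tr by (simp add: nrot_def)
  moreover have "a \<noteq> 0" using n tr by auto
  ultimately show ?thesis by blast
qed

text \<open>
  A rotation may be a half turn, where the previous formula gives the zero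
  quaternion. Multiplying by the half turns \<open>D i\<close> about the coordinate axes (and by the
  identity \<open>D 1\<close>) avoids this: the traces of the four products add up to 0, so at least one of
  them exceeds \<open>-1\<close>, and \<open>D i\<close> itself comes from a basis quaternion.
\<close>

lemma nrot_onto:
  assumes Q: "Q \<in> SO3"
  shows "\<exists>a. a \<bullet> a = 1 \<and> nrot a = Q"
proof -
  define D where "D = (\<lambda>i. nrot (axis i 1))"
  have D: "D i = (\<chi> j k. if j = k then (if i = 1 then 1 else if i = 2 then (if j = 1 then 1 else -1)
     else if i = 3 then (if j = 2 then 1 else -1) else (if j = 3 then 1 else -1)) else 0)" for i
    unfolding vec_eq_iff forall_3
    using exhaust_4[of i] by (auto simp: D_def nrot_def qrot_nth axis_def inner_quat)
  have DD: "D i ** D i = mat 1" for i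
    unfolding vec_eq_iff forall_3 by (auto simp: D matrix_matrix_mult_def sum_3 mat_def)
  have DS: "D i \<in> SO3" for i
  proof -
    have "transpose (D i) = D i" by (auto simp: D transpose_def vec_eq_iff)
    moreover have "det (D i) = 1"
      unfolding det_3 using exhaust_4[of i] by (auto simp: D)
    ultimately show ?thesis
      using DD[of i] by (simp add: SO3_def rotation_matrix_def orthogonal_matrix_def)
  qed
  have "trace (Q ** D 1) + trace (Q ** D 2) + trace (Q ** D 3) + trace (Q ** D 4) = 0"
    by (simp add: trace_3 matrix_matrix_mult_def sum_3 D)
  then obtain i where "trace (Q ** D i) > - 1"
    by (smt (verit))
  then obtain b where b: "b \<noteq> 0" "nrot b = Q ** D i"
    using nrot_onto_of_trace[of "Q ** D i"] Q DS SO3_closed_mult by blast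
  define c where "c = qmult b (axis i 1)"
  have "nrot c = (Q ** D i) ** D i"
    by (simp add: c_def nrot_qmult b(2)) (simp add: D_def)
  then have c: "nrot c = Q"
    by (simp add: DD flip: matrix_mul_assoc)
  have "c \<bullet> c = b \<bullet> b"
    by (simp add: c_def inner_qmult inner_axis_axis)
  then have "c \<noteq> 0" using b(1) by auto
  then show ?thesis
    using c by (intro exI[of _ "(1 / norm c) *\<^sub>R c"])
      (auto simp: nrot_scaleR dot_square_norm power2_eq_square)
qed

section \<open>Left invariance of the rotation measure\<close>

text \<open>
  Polar coordinates are used in the \<open>(x, y)\<close>-plane with radius \<open>p\<close>, then in the half-plane of
  \<open>(z, p)\<close> with radius \<open>s\<close>, then in the half-plane of \<open>(t, s)\<close> with radius \<open>\<rho>\<close>. The three Jacobian factors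
  \<open>p = s sin \<theta>\<close>, \<open>s = \<rho> sin \<psi>\<close> and \<open>\<rho>\<close> multiply to \<open>\<rho>\<^sup>3 sin\<^sup>2 \<psi> sin \<theta>\<close>.
\<close>

lemma nn_integral_quat_spherical:
  fixes G :: "real^4 \<Rightarrow> ennreal"
  assumes [measurable]: "G \<in> borel_measurable borel"
  shows "(\<integral>\<^sup>+q. G q \<partial>lborel) =
    (\<integral>\<^sup>+\<phi>\<in>{0..2*pi}. (\<integral>\<^sup>+\<theta>\<in>{0..pi}. (\<integral>\<^sup>+\<psi>\<in>{0..pi}. (\<integral>\<^sup>+\<rho>\<in>{0<..}.
       ennreal (sin \<theta>) * (ennreal ((sin \<psi>)\<^sup>2) * (ennreal (\<rho> ^ 3) *
         G (quat (\<rho> * cos \<psi>) (\<rho> * sin \<psi> * sin \<theta> * cos \<phi>) (\<rho> * sin \<psi> * sin \<theta> * sin \<phi>) (\<rho> * sin \<psi> * cos \<theta>))))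
       \<partial>lborel) \<partial>lborel) \<partial>lborel) \<partial>lborel)"
proof -
  have "(\<integral>\<^sup>+q. G q \<partial>lborel) =
      (\<integral>\<^sup>+t. \<integral>\<^sup>+z. \<integral>\<^sup>+x. \<integral>\<^sup>+y. G (quat t x y z) \<partial>lborel \<partial>lborel \<partial>lborel \<partial>lborel)"
    by (rule nn_integral_lborel_quat) measurable
  also have "\<dots> = (\<integral>\<^sup>+t. \<integral>\<^sup>+z. (\<integral>\<^sup>+\<phi>\<in>{0..2*pi}. (\<integral>\<^sup>+p\<in>{0<..}.
      ennreal p * G (quat t (p * cos \<phi>) (p * sin \<phi>) z) \<partial>lborel) \<partial>lborel) \<partial>lborel \<partial>lborel)"
    by (intro nn_integral_cong nn_integral_polar_plane) measurable
  also have "\<dots> = (\<integral>\<^sup>+t. (\<integral>\<^sup>+\<phi>\<in>{0..2*pi}. (\<integral>\<^sup>+z. (\<integral>\<^sup>+p\<in>{0<..}.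
      ennreal p * G (quat t (p * cos \<phi>) (p * sin \<phi>) z) \<partial>lborel) \<partial>lborel) \<partial>lborel) \<partial>lborel)"
    by (intro nn_integral_cong nn_integral_lborel_set_swap) measurable
  also have "\<dots> = (\<integral>\<^sup>+\<phi>\<in>{0..2*pi}. (\<integral>\<^sup>+t. \<integral>\<^sup>+z. (\<integral>\<^sup>+p\<in>{0<..}.
      ennreal p * G (quat t (p * cos \<phi>) (p * sin \<phi>) z) \<partial>lborel) \<partial>lborel \<partial>lborel) \<partial>lborel)"
    by (rule nn_integral_lborel_set_swap) measurable
  also have "\<dots> = (\<integral>\<^sup>+\<phi>\<in>{0..2*pi}. (\<integral>\<^sup>+t. (\<integral>\<^sup>+\<theta>\<in>{0..pi}. (\<integral>\<^sup>+s\<in>{0<..}.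
      ennreal s * (ennreal (s * sin \<theta>) * G (quat t (s * sin \<theta> * cos \<phi>) (s * sin \<theta> * sin \<phi>) (s * cos \<theta>)))
      \<partial>lborel) \<partial>lborel) \<partial>lborel) \<partial>lborel)"
    by (intro nn_integral_set_cong nn_integral_cong nn_integral_polar_half_plane) measurable
  also have "\<dots> = (\<integral>\<^sup>+\<phi>\<in>{0..2*pi}. (\<integral>\<^sup>+\<theta>\<in>{0..pi}. (\<integral>\<^sup>+t. (\<integral>\<^sup>+s\<in>{0<..}.
      ennreal s * (ennreal (s * sin \<theta>) * G (quat t (s * sin \<theta> * cos \<phi>) (s * sin \<theta> * sin \<phi>) (s * cos \<theta>)))
      \<partial>lborel) \<partial>lborel) \<partial>lborel) \<partial>lborel)"
    by (intro nn_integral_set_cong nn_integral_lborel_set_swap) measurable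
  also have "\<dots> = (\<integral>\<^sup>+\<phi>\<in>{0..2*pi}. (\<integral>\<^sup>+\<theta>\<in>{0..pi}. (\<integral>\<^sup>+\<psi>\<in>{0..pi}. (\<integral>\<^sup>+\<rho>\<in>{0<..}.
      ennreal \<rho> * (ennreal (\<rho> * sin \<psi>) * (ennreal (\<rho> * sin \<psi> * sin \<theta>) *
        G (quat (\<rho> * cos \<psi>) (\<rho> * sin \<psi> * sin \<theta> * cos \<phi>) (\<rho> * sin \<psi> * sin \<theta> * sin \<phi>) (\<rho> * sin \<psi> * cos \<theta>))))
      \<partial>lborel) \<partial>lborel) \<partial>lborel) \<partial>lborel)"
    by (intro nn_integral_set_cong nn_integral_polar_half_plane) measurable
  also have "\<dots> = (\<integral>\<^sup>+\<phi>\<in>{0..2*pi}. (\<integral>\<^sup>+\<theta>\<in>{0..pi}. (\<integral>\<^sup>+\<psi>\<in>{0..pi}. (\<integral>\<^sup>+\<rho>\<in>{0<..}.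
       ennreal (sin \<theta>) * (ennreal ((sin \<psi>)\<^sup>2) * (ennreal (\<rho> ^ 3) *
         G (quat (\<rho> * cos \<psi>) (\<rho> * sin \<psi> * sin \<theta> * cos \<phi>) (\<rho> * sin \<psi> * sin \<theta> * sin \<phi>) (\<rho> * sin \<psi> * cos \<theta>))))
       \<partial>lborel) \<partial>lborel) \<partial>lborel) \<partial>lborel)"
  proof (intro nn_integral_set_cong)
    fix \<theta> \<psi> \<rho> \<phi> :: real
    assume a: "\<theta> \<in> {0..pi}" "\<psi> \<in> {0..pi}" "\<rho> \<in> {0<..}"
    then have s: "0 \<le> sin \<theta>" "0 \<le> sin \<psi>" "0 \<le> \<rho>" by (auto intro: sin_ge_zero)
    have "ennreal \<rho> * (ennreal (\<rho> * sin \<psi>) * (ennreal (\<rho> * sin \<psi> * sin \<theta>) * X))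
        = ennreal (\<rho> * (\<rho> * sin \<psi>) * (\<rho> * sin \<psi> * sin \<theta>)) * X" for X
      using s by (simp only: ennreal_mult mult_nonneg_nonneg mult.assoc)
    moreover have "ennreal (sin \<theta>) * (ennreal ((sin \<psi>)\<^sup>2) * (ennreal (\<rho> ^ 3) * X))
        = ennreal (sin \<theta> * (sin \<psi>)\<^sup>2 * \<rho> ^ 3) * X" for X
      using s by (simp only: ennreal_mult mult_nonneg_nonneg mult.assoc zero_le_power)
    moreover have "\<rho> * (\<rho> * sin \<psi>) * (\<rho> * sin \<psi> * sin \<theta>) = sin \<theta> * (sin \<psi>)\<^sup>2 * \<rho> ^ 3"
      by (simp add: power2_eq_square power3_eq_cube)
    ultimately show "ennreal \<rho> * (ennreal (\<rho> * sin \<psi>) * (ennreal (\<rho> * sin \<psi> * sin \<theta>) *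
        G (quat (\<rho> * cos \<psi>) (\<rho> * sin \<psi> * sin \<theta> * cos \<phi>) (\<rho> * sin \<psi> * sin \<theta> * sin \<phi>) (\<rho> * sin \<psi> * cos \<theta>))))
      = ennreal (sin \<theta>) * (ennreal ((sin \<psi>)\<^sup>2) * (ennreal (\<rho> ^ 3) *
         G (quat (\<rho> * cos \<psi>) (\<rho> * sin \<psi> * sin \<theta> * cos \<phi>) (\<rho> * sin \<psi> * sin \<theta> * sin \<phi>) (\<rho> * sin \<psi> * cos \<theta>))))"
      by simp
  qed
  finally show ?thesis .
qed

text \<open>
  The angle doubles because a quaternion acts by multiplication from both
  sides: the matrix entries are quadratic in \<open>sin \<psi>\<close> and \<open>cos \<psi>\<close>.
\<close>

lemma nrot_half_angle:
  assumes "\<xi> \<in> sphere 0 1" "\<rho> \<noteq> 0"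
  shows "nrot (quat (\<rho> * cos \<psi>) (\<rho> * sin \<psi> * \<xi> $ 1) (\<rho> * sin \<psi> * \<xi> $ 2) (\<rho> * sin \<psi> * \<xi> $ 3))
    = rot \<xi> (2 * \<psi>)" (is "nrot (quat ?t ?x ?y ?z) = _")
    and "quat (\<rho> * cos \<psi>) (\<rho> * sin \<psi> * \<xi> $ 1) (\<rho> * sin \<psi> * \<xi> $ 2) (\<rho> * sin \<psi> * \<xi> $ 3)
      \<bullet> quat (\<rho> * cos \<psi>) (\<rho> * sin \<psi> * \<xi> $ 1) (\<rho> * sin \<psi> * \<xi> $ 2) (\<rho> * sin \<psi> * \<xi> $ 3) = \<rho>\<^sup>2"
proof -
  define a b c where abc: "a = \<xi> $ 1" "b = \<xi> $ 2" "c = \<xi> $ 3"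
  define s t where st_def: "s = sin \<psi>" "t = cos \<psi>"
  have n: "a\<^sup>2 + b\<^sup>2 + c\<^sup>2 = 1"
    using assms by (simp add: norm_vec_def L2_set_def sum_3 abc)
  have st: "s\<^sup>2 + t\<^sup>2 = 1" by (simp add: st_def)
  let ?q = "quat (\<rho> * t) (\<rho> * s * a) (\<rho> * s * b) (\<rho> * s * c)"
  have q: "?q \<bullet> ?q = \<rho>\<^sup>2"
    unfolding inner_quat quat_nth using n st by algebra
  then show "quat ?t ?x ?y ?z \<bullet> quat ?t ?x ?y ?z = \<rho>\<^sup>2" by (simp add: st_def abc)
  have e: "1 - cos (2 * \<psi>) = 2 * s\<^sup>2" "cos (2 * \<psi>) = t\<^sup>2 - s\<^sup>2" "sin (2 * \<psi>) = 2 * s * t"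
    by (simp_all add: cos_double sin_double st_def sin_squared_eq)
  have r: "rot \<xi> (2*\<psi>) $ 1 $ 1 = 2 * s\<^sup>2*a*a + (t\<^sup>2 - s\<^sup>2)" "rot \<xi> (2*\<psi>) $ 1 $ 2 = 2 * s\<^sup>2*a*b - 2 * s*t*c"
    "rot \<xi> (2*\<psi>) $ 1 $ 3 = 2 * s\<^sup>2*a*c + 2 * s*t*b" "rot \<xi> (2*\<psi>) $ 2 $ 1 = 2 * s\<^sup>2*b*a + 2 * s*t*c"
    "rot \<xi> (2*\<psi>) $ 2 $ 2 = 2 * s\<^sup>2*b*b + (t\<^sup>2 - s\<^sup>2)" "rot \<xi> (2*\<psi>) $ 2 $ 3 = 2 * s\<^sup>2*b*c - 2 * s*t*a"
    "rot \<xi> (2*\<psi>) $ 3 $ 1 = 2 * s\<^sup>2*c*a - 2 * s*t*b" "rot \<xi> (2*\<psi>) $ 3 $ 2 = 2 * s\<^sup>2*c*b + 2 * s*t*a"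
    "rot \<xi> (2*\<psi>) $ 3 $ 3 = 2 * s\<^sup>2*c*c + (t\<^sup>2 - s\<^sup>2)"
    unfolding rot_def vector_add_component vector_scaleR_component e
    using st by (simp_all add: matrix_def cross3_def mat_def axis_def abc diff_eq_eq)
  have "qrot ?q = \<rho>\<^sup>2 *\<^sub>R rot \<xi> (2*\<psi>)"
    unfolding vec_eq_iff forall_3 vector_scaleR_component r qrot_nth quat_nth real_scaleR_def
    apply (intro conjI)
    subgoal using n by algebra
    subgoal by (simp add: power2_eq_square algebra_simps)
    subgoal by (simp add: power2_eq_square algebra_simps)
    subgoal by (simp add: power2_eq_square algebra_simps)
    subgoal using n by algebra
    subgoal by (simp add: power2_eq_square algebra_simps)
    subgoal by (simp add: power2_eq_square algebra_simps)
    subgoal by (simp add: power2_eq_square algebra_simps)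
    subgoal using n by algebra
    done
  with q assms(2) have "nrot ?q = rot \<xi> (2*\<psi>)" by (simp add: nrot_def)
  then show "nrot (quat ?t ?x ?y ?z) = rot \<xi> (2 * \<psi>)" by (simp add: st_def abc)
qed

lemma finite_measure_sphere_measure: "finite_measure sphere_measure"
  using emeasure_sphere_measure
  by (intro finite_measureI) (simp add: sphere_measure_def space_restrict_space)

lemma space_sphere_measure [simp]: "space sphere_measure = sphere 0 1"
  by (simp add: sphere_measure_def space_restrict_space)

lemma sets_sphere_measure [measurable_cong]: "sets sphere_measure = sets (restrict_space borel (sphere 0 1))"
  by (simp add: sphere_measure_def)

lemma borel_measurable_matrix_mult [measurable (raw)]:
  fixes f :: "'z \<Rightarrow> real^'m^'n" and g :: "'z \<Rightarrow> real^'k^'m"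
  assumes "f \<in> borel_measurable M" "g \<in> borel_measurable M"
  shows "(\<lambda>x. f x ** g x) \<in> borel_measurable M"
proof -
  have "continuous_on UNIV (\<lambda>p::(real^'m^'n) \<times> (real^'k^'m). \<chi> i j. \<Sum>k\<in>UNIV. fst p $ i $ k * snd p $ k $ j)"
    by (intro continuous_on_vec_lambda continuous_intros)
  then have "(\<lambda>p::(real^'m^'n) \<times> (real^'k^'m). fst p ** snd p) \<in> borel_measurable borel"
    by (intro borel_measurable_continuous_onI) (simp add: matrix_matrix_mult_def)
  then have "(\<lambda>p::(real^'m^'n) \<times> (real^'k^'m). fst p ** snd p) \<in> borel \<Otimes>\<^sub>M borel \<rightarrow>\<^sub>M borel"
    by (simp add: borel_prod)
  from measurable_compose[OF measurable_Pair[OF assms] this] show ?thesis by simp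
qed

lemma borel_measurable_rot [measurable (raw)]:
  assumes "f \<in> borel_measurable M" "g \<in> borel_measurable M"
  shows "(\<lambda>x. rot (f x) (g x)) \<in> borel_measurable M"
proof -
  have "(\<lambda>p::real \<times> (real^3). rot (snd p) (fst p)) \<in> borel \<Otimes>\<^sub>M borel \<rightarrow>\<^sub>M borel"
    using borel_measurable_continuous_onI[OF continuous_rot] by (simp add: borel_prod)
  from measurable_compose[OF measurable_Pair[OF assms(2,1)] this] show ?thesis by simp
qed

text \<open>
  The substitution \<open>\<omega> = 2\<psi>\<close> with \<open>2 sin\<^sup>2 \<psi> = 1 - cos \<omega>\<close>, one factor \<open>1/2\<close> coming from \<open>d\<psi>\<close> and one from
  \<open>sin\<^sup>2 \<psi>\<close>. The condition \<open>cos \<psi> > 0\<close> selects the angles \<open>\<omega> < \<pi>\<close>.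
\<close>

lemma nn_integral_half_angle:
  fixes f :: "real \<Rightarrow> ennreal"
  assumes [measurable]: "f \<in> borel_measurable borel"
  shows "(\<integral>\<^sup>+\<psi>\<in>{0..pi}. ennreal ((sin \<psi>)\<^sup>2) * (f (2 * \<psi>) * indicator {\<psi>. 0 < cos \<psi>} \<psi>) \<partial>lborel)
    = ennreal (1/4) * (\<integral>\<^sup>+\<omega>\<in>{0..pi}. (f \<omega> * ennreal (1 - cos \<omega>)) \<partial>lborel)"
proof -
  have [measurable]: "{\<psi>::real. 0 < cos \<psi>} \<in> sets borel"
    by (intro borel_open open_Collect_less continuous_intros)
  have "(\<integral>\<^sup>+\<psi>\<in>{0..pi}. ennreal ((sin \<psi>)\<^sup>2) * (f (2 * \<psi>) * indicator {\<psi>. 0 < cos \<psi>} \<psi>) \<partial>lborel)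
      = ennreal (1/2) * (\<integral>\<^sup>+\<omega>. ennreal ((sin (\<omega>/2))\<^sup>2) * (f \<omega> * indicator {\<psi>. 0 < cos \<psi>} (\<omega>/2))
          * indicator {0..pi} (\<omega>/2) \<partial>lborel)"
    by (subst nn_integral_real_affine[where c = "1/2" and t = 0]) auto
  also have "(\<integral>\<^sup>+\<omega>. ennreal ((sin (\<omega>/2))\<^sup>2) * (f \<omega> * indicator {\<psi>. 0 < cos \<psi>} (\<omega>/2))
          * indicator {0..pi} (\<omega>/2) \<partial>lborel)
      = (\<integral>\<^sup>+\<omega>. ennreal (1/2) * (f \<omega> * ennreal (1 - cos \<omega>) * indicator {0..pi} \<omega>) \<partial>lborel)"
  proof (rule nn_integral_cong_AE)
    have eq: "ennreal ((sin (\<omega>/2))\<^sup>2) * (f \<omega> * indicator {\<psi>. 0 < cos \<psi>} (\<omega>/2)) * indicator {0..pi} (\<omega>/2)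
        = ennreal (1/2) * (f \<omega> * ennreal (1 - cos \<omega>) * indicator {0..pi} \<omega>)" if "\<omega> \<noteq> pi" for \<omega> :: real
    proof -
      have "1 - cos \<omega> = 2 * (sin (\<omega>/2))\<^sup>2"
        using cos_double_sin[of "\<omega>/2"] by simp
      then have s: "ennreal (1/2) * ennreal (1 - cos \<omega>) = ennreal ((sin (\<omega>/2))\<^sup>2)"
        by (subst ennreal_mult[symmetric]) auto
      have c: "indicator {\<psi>. 0 < cos \<psi>} (\<omega>/2) * indicator {0..pi} (\<omega>/2) = (indicator {0..pi} \<omega> :: ennreal)"
      proof (cases "\<omega> \<in> {0..2*pi}")
        case True
        show ?thesis
        proof (cases "\<omega> < pi")
          case True
          then have "0 < cos (\<omega>/2)" using \<open>\<omega> \<in> {0..2*pi}\<close> by (intro cos_gt_zero_pi) auto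
          then show ?thesis using True \<open>\<omega> \<in> {0..2*pi}\<close> by auto
        next
          case False
          then have "cos (\<omega>/2) < cos (pi/2)"
            using \<open>\<omega> \<in> {0..2*pi}\<close> \<open>\<omega> \<noteq> pi\<close> by (intro cos_monotone_0_pi) auto
          then show ?thesis using False \<open>\<omega> \<noteq> pi\<close> by auto
        qed
      next
        case False
        then show ?thesis by (auto simp: indicator_def)
      qed
      show ?thesis
        unfolding s[symmetric] c[symmetric] by (simp only: mult.assoc mult.commute mult.left_commute)
    qed
    show "AE \<omega> in lborel. ennreal ((sin (\<omega>/2))\<^sup>2) * (f \<omega> * indicator {\<psi>. 0 < cos \<psi>} (\<omega>/2)) * indicator {0..pi} (\<omega>/2)
        = ennreal (1/2) * (f \<omega> * ennreal (1 - cos \<omega>) * indicator {0..pi} \<omega>)"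
      using AE_lborel_singleton[of pi] by eventually_elim (rule eq)
  qed
  also have "\<dots> = ennreal (1/2) * (\<integral>\<^sup>+\<omega>\<in>{0..pi}. (f \<omega> * ennreal (1 - cos \<omega>)) \<partial>lborel)"
    by (rule nn_integral_cmult) measurable
  also have "ennreal (1/2) * (ennreal (1/2) * X) = ennreal (1/4) * X" for X
    by (subst mult.assoc[symmetric], subst ennreal_mult[symmetric]) auto
  finally show ?thesis .
qed

text \<open>
  Opposite quaternions give the same rotation, so the half of the ball with
  positive real part covers each rotation of angle below \<open>\<pi>\<close> by exactly one ray. The factor \<open>1/32\<close> is
  \<open>1/4 \<sqdot> 1/4 \<sqdot> 1/2\<close>: the radial integral of \<open>\<rho>\<^sup>3\<close>, the half-angle substitution, and the factor 2 in the
  axis-angle formula.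
\<close>

lemma nn_integral_nrot_half_ball:
  fixes f :: "real^3^3 \<Rightarrow> ennreal"
  assumes [measurable]: "f \<in> borel_measurable borel"
  shows "(\<integral>\<^sup>+q. f (nrot q) * indicator {q. q \<bullet> q \<le> 1 \<and> 0 < q $ 1} q \<partial>lborel)
    = ennreal (1/32) * (\<integral>\<^sup>+Q. f Q \<partial>SO3_measure)"
proof -
  interpret S: finite_measure sphere_measure by (rule finite_measure_sphere_measure)
  have [measurable]: "(\<lambda>q. q $ 1) \<in> borel_measurable (borel :: (real^4) measure)"
    by (intro borel_measurable_continuous_onI continuous_intros)
  have [measurable]: "{\<psi>::real. 0 < cos \<psi>} \<in> sets borel"
    by (intro borel_open open_Collect_less continuous_intros)
  have [measurable]: "(\<lambda>x. x) \<in> sphere_measure \<rightarrow>\<^sub>M borel" by (rule measurable_id_sphere_measure)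
  have [measurable]: "(\<lambda>x. x) \<in> restrict_space borel (sphere 0 1) \<rightarrow>\<^sub>M (borel :: (real^3) measure)"
    by (rule measurable_restrict_space1) simp
  define K where "K = (\<integral>\<^sup>+\<rho>\<in>{0<..}. ennreal (\<rho> ^ 3) * indicator {..1} \<rho> \<partial>lborel)"
  have K: "K = ennreal (1/4)"
  proof -
    have "K = (\<integral>\<^sup>+\<rho>. ennreal (\<rho> ^ 3) * indicator {0..1} \<rho> \<partial>lborel)"
      unfolding K_def by (intro nn_integral_cong) (auto simp: indicator_def)
    also have "\<dots> = ennreal (1 ^ 4 / 4 - 0 ^ 4 / 4)"
      by (rule nn_integral_FTC_Icc) (auto intro!: derivative_eq_intros)
    finally show ?thesis by simp
  qed
  define h where "h = (\<lambda>\<xi>. (\<integral>\<^sup>+\<psi>\<in>{0..pi}. ennreal ((sin \<psi>)\<^sup>2) *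
      (f (rot \<xi> (2 * \<psi>)) * indicator {\<psi>. 0 < cos \<psi>} \<psi>) \<partial>lborel))"
  have [measurable]: "h \<in> borel_measurable borel"
    unfolding h_def by measurable
  have [measurable]: "(\<lambda>(\<omega>, \<xi>). f (rot \<xi> \<omega>) * ennreal (1 - cos \<omega>) * indicator {0..pi} \<omega>)
      \<in> borel_measurable (lborel \<Otimes>\<^sub>M sphere_measure)"
    unfolding case_prod_unfold by measurable
  let ?G = "\<lambda>q. f (nrot q) * indicator {q. q \<bullet> q \<le> 1 \<and> 0 < q $ 1} q"
  have "(\<integral>\<^sup>+q. ?G q \<partial>lborel) =
    (\<integral>\<^sup>+\<phi>\<in>{0..2*pi}. (\<integral>\<^sup>+\<theta>\<in>{0..pi}. (\<integral>\<^sup>+\<psi>\<in>{0..pi}. (\<integral>\<^sup>+\<rho>\<in>{0<..}.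
       ennreal (sin \<theta>) * (ennreal ((sin \<psi>)\<^sup>2) * (ennreal (\<rho> ^ 3) *
         ?G (quat (\<rho> * cos \<psi>) (\<rho> * sin \<psi> * sin \<theta> * cos \<phi>) (\<rho> * sin \<psi> * sin \<theta> * sin \<phi>) (\<rho> * sin \<psi> * cos \<theta>))))
       \<partial>lborel) \<partial>lborel) \<partial>lborel) \<partial>lborel)"
    by (rule nn_integral_quat_spherical) measurable
  also have "\<dots> = (\<integral>\<^sup>+\<phi>\<in>{0..2*pi}. (\<integral>\<^sup>+\<theta>\<in>{0..pi}. ennreal (sin \<theta>) * (h (sph (\<phi>, \<theta>)) * K) \<partial>lborel) \<partial>lborel)"
  proof (intro nn_integral_set_cong)
    fix \<phi> \<theta> :: real
    define \<xi> where "\<xi> = sph (\<phi>, \<theta>)"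
    have xi: "\<xi> \<in> sphere 0 1" unfolding \<xi>_def by (rule sph_in_sphere)
    have G: "?G (quat (\<rho> * cos \<psi>) (\<rho> * sin \<psi> * sin \<theta> * cos \<phi>) (\<rho> * sin \<psi> * sin \<theta> * sin \<phi>) (\<rho> * sin \<psi> * cos \<theta>))
        = (f (rot \<xi> (2 * \<psi>)) * indicator {\<psi>. 0 < cos \<psi>} \<psi>) * indicator {..1} \<rho>" if "\<rho> > 0" for \<psi> \<rho>
    proof -
      have q: "quat (\<rho> * cos \<psi>) (\<rho> * sin \<psi> * sin \<theta> * cos \<phi>) (\<rho> * sin \<psi> * sin \<theta> * sin \<phi>) (\<rho> * sin \<psi> * cos \<theta>)
        = quat (\<rho> * cos \<psi>) (\<rho> * sin \<psi> * \<xi> $ 1) (\<rho> * sin \<psi> * \<xi> $ 2) (\<rho> * sin \<psi> * \<xi> $ 3)"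
        by (simp add: \<xi>_def sph_def) (simp only: mult.assoc mult.commute mult.left_commute)
      have "\<rho>\<^sup>2 \<le> 1 \<longleftrightarrow> \<rho> \<le> 1" using that by (simp add: abs_square_le_1)
      moreover have "0 < \<rho> * cos \<psi> \<longleftrightarrow> 0 < cos \<psi>" using that by (simp add: zero_less_mult_iff)
      moreover have "\<rho> \<noteq> 0" using that by simp
      ultimately show ?thesis
        unfolding q nrot_half_angle(1)[OF xi \<open>\<rho> \<noteq> 0\<close>]
        using nrot_half_angle(2)[OF xi \<open>\<rho> \<noteq> 0\<close>, of \<psi>] by (auto simp: indicator_def)
    qed
    have "(\<integral>\<^sup>+\<psi>\<in>{0..pi}. (\<integral>\<^sup>+\<rho>\<in>{0<..}.
       ennreal (sin \<theta>) * (ennreal ((sin \<psi>)\<^sup>2) * (ennreal (\<rho> ^ 3) *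
         ?G (quat (\<rho> * cos \<psi>) (\<rho> * sin \<psi> * sin \<theta> * cos \<phi>) (\<rho> * sin \<psi> * sin \<theta> * sin \<phi>) (\<rho> * sin \<psi> * cos \<theta>))))
       \<partial>lborel) \<partial>lborel)
      = (\<integral>\<^sup>+\<psi>\<in>{0..pi}. (\<integral>\<^sup>+\<rho>. (ennreal (sin \<theta>) * (ennreal ((sin \<psi>)\<^sup>2) *
           (f (rot \<xi> (2 * \<psi>)) * indicator {\<psi>. 0 < cos \<psi>} \<psi>)))
          * (ennreal (\<rho> ^ 3) * indicator {..1} \<rho> * indicator {0<..} \<rho>) \<partial>lborel) \<partial>lborel)"
    proof (intro nn_integral_set_cong nn_integral_cong)
      fix \<psi> \<rho> :: real
      show "ennreal (sin \<theta>) * (ennreal ((sin \<psi>)\<^sup>2) * (ennreal (\<rho> ^ 3) *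
         ?G (quat (\<rho> * cos \<psi>) (\<rho> * sin \<psi> * sin \<theta> * cos \<phi>) (\<rho> * sin \<psi> * sin \<theta> * sin \<phi>) (\<rho> * sin \<psi> * cos \<theta>))))
         * indicator {0<..} \<rho>
        = (ennreal (sin \<theta>) * (ennreal ((sin \<psi>)\<^sup>2) *
           (f (rot \<xi> (2 * \<psi>)) * indicator {\<psi>. 0 < cos \<psi>} \<psi>)))
          * (ennreal (\<rho> ^ 3) * indicator {..1} \<rho> * indicator {0<..} \<rho>)"
      proof (cases "\<rho> > 0")
        case True
        show ?thesis
          unfolding G[OF True] by (simp only: mult.assoc mult.commute mult.left_commute)
      qed simp
    qed
    also have "\<dots> = (\<integral>\<^sup>+\<psi>\<in>{0..pi}. (ennreal (sin \<theta>) * (ennreal ((sin \<psi>)\<^sup>2) *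
           (f (rot \<xi> (2 * \<psi>)) * indicator {\<psi>. 0 < cos \<psi>} \<psi>))) * K \<partial>lborel)"
      unfolding K_def by (intro nn_integral_set_cong nn_integral_cmult) measurable
    also have "\<dots> = (\<integral>\<^sup>+\<psi>. (ennreal (sin \<theta>) * K) * (ennreal ((sin \<psi>)\<^sup>2) *
           (f (rot \<xi> (2 * \<psi>)) * indicator {\<psi>. 0 < cos \<psi>} \<psi>) * indicator {0..pi} \<psi>) \<partial>lborel)"
      by (intro nn_integral_cong) (simp only: mult.assoc mult.commute mult.left_commute)
    also have "\<dots> = (ennreal (sin \<theta>) * K) * h \<xi>"
      unfolding h_def by (rule nn_integral_cmult) measurable
    also have "\<dots> = ennreal (sin \<theta>) * (h \<xi> * K)"
      by (simp only: mult.assoc mult.commute mult.left_commute)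
    finally show "(\<integral>\<^sup>+\<psi>\<in>{0..pi}. (\<integral>\<^sup>+\<rho>\<in>{0<..}.
       ennreal (sin \<theta>) * (ennreal ((sin \<psi>)\<^sup>2) * (ennreal (\<rho> ^ 3) *
         ?G (quat (\<rho> * cos \<psi>) (\<rho> * sin \<psi> * sin \<theta> * cos \<phi>) (\<rho> * sin \<psi> * sin \<theta> * sin \<phi>) (\<rho> * sin \<psi> * cos \<theta>))))
       \<partial>lborel) \<partial>lborel) = ennreal (sin \<theta>) * (h (sph (\<phi>, \<theta>)) * K)" unfolding \<xi>_def .
  qed
  also have "\<dots> = (\<integral>\<^sup>+\<xi>. h \<xi> * K \<partial>sphere_measure)"
    by (rule nn_integral_sphere_measure[symmetric]) measurable
  also have "\<dots> = (\<integral>\<^sup>+\<xi>. ennreal (1/16) *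
      (\<integral>\<^sup>+\<omega>\<in>{0..pi}. (f (rot \<xi> \<omega>) * ennreal (1 - cos \<omega>)) \<partial>lborel) \<partial>sphere_measure)"
  proof (rule nn_integral_cong)
    fix \<xi> :: "real^3"
    have h: "h \<xi> = ennreal (1/4) * (\<integral>\<^sup>+\<omega>\<in>{0..pi}. (f (rot \<xi> \<omega>) * ennreal (1 - cos \<omega>)) \<partial>lborel)"
      unfolding h_def by (rule nn_integral_half_angle) measurable
    have "ennreal (1/16) = ennreal (1/4) * ennreal (1/4)"
      by (subst ennreal_mult[symmetric]) auto
    then show "h \<xi> * K = ennreal (1/16) * (\<integral>\<^sup>+\<omega>\<in>{0..pi}. (f (rot \<xi> \<omega>) * ennreal (1 - cos \<omega>)) \<partial>lborel)"
      unfolding h K by (simp only: mult.assoc mult.commute mult.left_commute)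
  qed
  also have "\<dots> = ennreal (1/16) * (\<integral>\<^sup>+\<xi>. \<integral>\<^sup>+\<omega>.
      f (rot \<xi> \<omega>) * ennreal (1 - cos \<omega>) * indicator {0..pi} \<omega> \<partial>lborel \<partial>sphere_measure)"
    by (rule nn_integral_cmult) measurable
  also have "(\<integral>\<^sup>+\<xi>. \<integral>\<^sup>+\<omega>.
      f (rot \<xi> \<omega>) * ennreal (1 - cos \<omega>) * indicator {0..pi} \<omega> \<partial>lborel \<partial>sphere_measure)
    = (\<integral>\<^sup>+\<omega>. \<integral>\<^sup>+\<xi>.
      f (rot \<xi> \<omega>) * ennreal (1 - cos \<omega>) * indicator {0..pi} \<omega> \<partial>sphere_measure \<partial>lborel)"
  proof -
    interpret pair_sigma_finite "lborel :: real measure" sphere_measure ..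
    show ?thesis
      using Fubini[of "\<lambda>(\<omega>, \<xi>). f (rot \<xi> \<omega>) * ennreal (1 - cos \<omega>) * indicator {0..pi} \<omega>"] by simp
  qed
  also have "\<dots> = (\<integral>\<^sup>+\<omega>\<in>{0..pi}. (\<integral>\<^sup>+\<xi>. f (rot \<xi> \<omega>) * ennreal (1 - cos \<omega>) \<partial>sphere_measure) \<partial>lborel)"
    by (intro nn_integral_cong nn_integral_multc) measurable
  finally have J: "(\<integral>\<^sup>+q. ?G q \<partial>lborel) = ennreal (1/16) *
      (\<integral>\<^sup>+\<omega>\<in>{0..pi}. (\<integral>\<^sup>+\<xi>. f (rot \<xi> \<omega>) * ennreal (1 - cos \<omega>) \<partial>sphere_measure) \<partial>lborel)" .
  have "ennreal (1/16) = ennreal (1/32) * 2"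
    by (simp flip: ennreal_mult ennreal_numeral)
  then show ?thesis
    unfolding J by (subst nn_integral_SO3_measure) (auto simp: mult.assoc intro: measurable_restrict_space1)
qed

text \<open>
  The full ball is needed for invariance, since multiplication by a unit
  quaternion does not preserve the half ball. The two halves contribute equally
  because \<open>nrot (- q) = nrot q\<close>.
\<close>

lemma nn_integral_nrot_ball:
  fixes f :: "real^3^3 \<Rightarrow> ennreal"
  assumes [measurable]: "f \<in> borel_measurable borel"
  shows "(\<integral>\<^sup>+q. f (nrot q) * indicator {q. q \<bullet> q \<le> 1} q \<partial>lborel)
    = ennreal (1/16) * (\<integral>\<^sup>+Q. f Q \<partial>SO3_measure)"
proof -
  have [measurable]: "(\<lambda>q. q $ 1) \<in> borel_measurable (borel :: (real^4) measure)"
    by (intro borel_measurable_continuous_onI continuous_intros)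
  let ?H = "\<lambda>q. f (nrot q) * indicator {q. q \<bullet> q \<le> 1 \<and> 0 < q $ 1} q"
  have "(\<integral>\<^sup>+q. indicator {q. q $ 1 = 0} q \<partial>(lborel :: (real^4) measure)) = 0"
  proof -
    have "AE t in lborel. (\<integral>\<^sup>+z. \<integral>\<^sup>+x. \<integral>\<^sup>+y. indicator {q. q $ 1 = 0} (quat t x y z) \<partial>lborel \<partial>lborel \<partial>lborel) = 0"
      using AE_lborel_singleton[of "0::real"] by eventually_elim (simp add: indicator_def)
    then show ?thesis
      by (subst nn_integral_lborel_quat) (measurable, subst nn_integral_0_iff_AE, measurable)
  qed
  then have ae: "AE q in lborel. (q :: real^4) $ 1 \<noteq> 0"
    by (subst (asm) nn_integral_0_iff_AE) (auto simp: indicator_def)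
  have neg: "nrot (- q) = nrot q" for q using nrot_scaleR[of "-1" q] by simp
  have "(\<integral>\<^sup>+q. f (nrot q) * indicator {q. q \<bullet> q \<le> 1} q \<partial>lborel) = (\<integral>\<^sup>+q. ?H q + ?H (- q) \<partial>lborel)"
    using ae by (intro nn_integral_cong_AE, eventually_elim) (auto simp: indicator_def neg)
  also have "\<dots> = (\<integral>\<^sup>+q. ?H q \<partial>lborel) + (\<integral>\<^sup>+q. ?H (- q) \<partial>lborel)"
    by (rule nn_integral_add) measurable
  also have "(\<integral>\<^sup>+q. ?H (- q) \<partial>lborel) = (\<integral>\<^sup>+q. ?H q \<partial>distr lborel borel uminus)"
    by (rule nn_integral_distr[symmetric]) measurable
  also have "distr lborel borel uminus = (lborel :: (real^4) measure)"
    by (rule lborel_distr_orthogonal_transformation) (simp add: orthogonal_transformation_neg orthogonal_transformation_id)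
  finally show ?thesis
    unfolding nn_integral_nrot_half_ball[OF assms]
    by (simp flip: distrib_right ennreal_plus)
qed

text \<open>
  With \<open>Q = nrot a\<close>, translation by \<open>Q\<close> lifts to multiplication by the unit quaternion \<open>a\<close>, an
  isometry that maps the ball onto itself.
\<close>

lemma nn_integral_SO3_measure_left_invariant:
  fixes f :: "real^3^3 \<Rightarrow> ennreal"
  assumes [measurable]: "f \<in> borel_measurable borel" and Q: "Q \<in> SO3"
  shows "(\<integral>\<^sup>+A. f (Q ** A) \<partial>SO3_measure) = (\<integral>\<^sup>+A. f A \<partial>SO3_measure)"
proof -
  obtain a where a: "a \<bullet> a = 1" "nrot a = Q" using nrot_onto[OF Q] by blast
  have ort: "orthogonal_transformation (qmult a)" using a(1) by (rule orthogonal_transformation_qmult)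
  have [measurable]: "qmult a \<in> borel_measurable borel"
    using ort by (intro borel_measurable_continuous_onI linear_continuous_on)
      (simp add: linear_conv_bounded_linear[symmetric] orthogonal_transformation_linear)
  have [measurable]: "(\<lambda>A :: real^3^3. Q ** A) \<in> borel_measurable borel"
    by measurable
  let ?B = "indicator {q :: real^4. q \<bullet> q \<le> 1} :: real^4 \<Rightarrow> ennreal"
  have "ennreal (1/16) * (\<integral>\<^sup>+A. f (Q ** A) \<partial>SO3_measure) = (\<integral>\<^sup>+q. f (Q ** nrot q) * ?B q \<partial>lborel)"
    by (rule nn_integral_nrot_ball[symmetric]) measurable
  also have "\<dots> = (\<integral>\<^sup>+q. f (nrot (qmult a q)) * ?B (qmult a q) \<partial>lborel)"
    by (simp add: nrot_qmult a inner_qmult indicator_def)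
  also have "\<dots> = (\<integral>\<^sup>+q. f (nrot q) * ?B q \<partial>distr lborel borel (qmult a))"
    by (rule nn_integral_distr[symmetric]) measurable
  also have "\<dots> = ennreal (1/16) * (\<integral>\<^sup>+A. f A \<partial>SO3_measure)"
    unfolding lborel_distr_orthogonal_transformation[OF ort] by (rule nn_integral_nrot_ball) measurable
  finally show ?thesis
    by (subst (asm) ennreal_mult_cancel_left) auto
qed

section \<open>Bounds in the space of square-integrable functions\<close>

lemma L2_iff:
  "f \<in> L2 M \<longleftrightarrow> f \<in> borel_measurable M \<and> (\<integral>\<^sup>+x. ennreal ((cmod (f x))\<^sup>2) \<partial>M) < \<infinity>"
  by (auto simp: L2_def integrable_iff_bounded)

lemma L2_norm_eq:
  "f \<in> borel_measurable M \<Longrightarrow> L2_norm M f = sqrt (enn2real (\<integral>\<^sup>+x. ennreal ((cmod (f x))\<^sup>2) \<partial>M))"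
  unfolding L2_norm_def by (subst integral_eq_nn_integral) auto

text \<open>
  Estimates are proved for nonnegative integrals, where no integrability
  has to be checked; this turns them into statements about \<^const>\<open>L2\<close> and its norm.
\<close>

lemma L2_operator_boundI:
  assumes f: "f \<in> L2 M" and F: "F \<in> borel_measurable N" and c: "0 \<le> c"
    and le: "(\<integral>\<^sup>+y. ennreal ((cmod (F y))\<^sup>2) \<partial>N) \<le> ennreal c * (\<integral>\<^sup>+x. ennreal ((cmod (f x))\<^sup>2) \<partial>M)"
  shows "F \<in> L2 N" "L2_norm N F \<le> sqrt c * L2_norm M f"
proof -
  have fin: "ennreal c * (\<integral>\<^sup>+x. ennreal ((cmod (f x))\<^sup>2) \<partial>M) < \<infinity>"
    using f by (simp add: L2_iff ennreal_mult_less_top)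
  with le F show "F \<in> L2 N" by (auto simp: L2_iff)
  have "enn2real (\<integral>\<^sup>+y. ennreal ((cmod (F y))\<^sup>2) \<partial>N)
      \<le> enn2real (ennreal c * (\<integral>\<^sup>+x. ennreal ((cmod (f x))\<^sup>2) \<partial>M))"
    using le fin by (intro enn2real_mono) auto
  then show "L2_norm N F \<le> sqrt c * L2_norm M f"
    using f F c by (simp add: L2_norm_eq L2_iff enn2real_mult flip: real_sqrt_mult)
qed

lemma L2_mult_cnj_integrable:
  assumes "f \<in> L2 M" "g \<in> L2 M"
  shows "integrable M (\<lambda>x. f x * cnj (g x))"
proof (rule Bochner_Integration.integrable_bound)
  show "integrable M (\<lambda>x. (cmod (f x))\<^sup>2 + (cmod (g x))\<^sup>2)"
    using assms by (simp add: L2_def)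
  have [measurable]: "f \<in> borel_measurable M" "g \<in> borel_measurable M"
    using assms by (auto simp: L2_def)
  have "(\<lambda>x. cnj (g x)) \<in> borel_measurable M"
    by (rule borel_measurable_continuous_on[of cnj]) (auto intro: continuous_intros)
  then show "(\<lambda>x. f x * cnj (g x)) \<in> borel_measurable M" by measurable
  have "a * b \<le> a\<^sup>2 + b\<^sup>2" if "0 \<le> a" "0 \<le> b" for a b :: real
    using sum_squares_bound[of a b] mult_nonneg_nonneg[OF that] by linarith
  then show "AE x in M. norm (f x * cnj (g x)) \<le> norm ((cmod (f x))\<^sup>2 + (cmod (g x))\<^sup>2)"
    by (simp add: norm_mult)
qed

lemma L2_integrable_finite:
  assumes "finite_measure M" "f \<in> L2 M"
  shows "integrable M f"
proof -
  interpret finite_measure M by fact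
  have "(\<lambda>_. 1) \<in> L2 M" by (simp add: L2_def)
  from L2_mult_cnj_integrable[OF assms(2) this] show ?thesis by simp
qed

text \<open>
  The Cauchy-Schwarz inequality against the constant function 1, from the
  nonnegativity of the integral of \<open>(\<bar>f\<bar> - t)\<^sup>2\<close>. If \<open>f\<close> is not square integrable, then \<open>M\<close> is not the
  zero measure and the right-hand side is infinite.
\<close>

lemma norm_integral_squared_le:
  assumes "finite_measure M" and [measurable]: "f \<in> borel_measurable M"
  shows "ennreal ((cmod (\<integral>x. f x \<partial>M))\<^sup>2)
    \<le> emeasure M (space M) * (\<integral>\<^sup>+x. ennreal ((cmod (f x))\<^sup>2) \<partial>M)"
proof -
  interpret finite_measure M by fact
  define m where "m = measure M (space M)"
  have em: "emeasure M (space M) = ennreal m" by (simp add: m_def emeasure_eq_measure)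
  show ?thesis
  proof (cases "f \<in> L2 M")
    case True
    then have if2: "integrable M (\<lambda>x. (cmod (f x))\<^sup>2)" by (simp add: L2_def)
    have fi: "integrable M (\<lambda>x. cmod (f x))"
      using L2_integrable_finite[OF assms(1) True] by simp
    define I where "I = (\<integral>x. cmod (f x) \<partial>M)"
    define B where "B = (\<integral>x. (cmod (f x))\<^sup>2 \<partial>M)"
    (* The quadratic polynomial is evaluated below at its minimum, the mean value I / m. *)
    have q: "0 \<le> B - 2 * t * I + t\<^sup>2 * m" for t
    proof -
      have "0 \<le> (\<integral>x. (cmod (f x) - t)\<^sup>2 \<partial>M)" by (rule integral_nonneg_AE) simp
      also have "(\<lambda>x. (cmod (f x) - t)\<^sup>2) = (\<lambda>x. (cmod (f x))\<^sup>2 - 2 * t * cmod (f x) + t\<^sup>2)"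
        by (simp add: power2_eq_square algebra_simps)
      also have "(\<integral>x. (cmod (f x))\<^sup>2 - 2 * t * cmod (f x) + t\<^sup>2 \<partial>M) = B - 2 * t * I + t\<^sup>2 * m"
        using if2 fi by (simp add: B_def I_def m_def mult.commute)
      finally show ?thesis .
    qed
    have "I\<^sup>2 \<le> m * B"
    proof (cases "m = 0")
      case True
      then have "AE x in M. cmod (f x) = 0"
        using em by (intro AE_I[of _ _ "space M"]) auto
      then have "I = 0" unfolding I_def by (subst integral_cong_AE[of _ M "\<lambda>_. 0"]) auto
      then show ?thesis using True by simp
    next
      case False
      then have "m > 0" by (simp add: m_def less_le)
      then have "0 \<le> m * (B - 2 * (I / m) * I + (I / m)\<^sup>2 * m)"
        using q[of "I / m"] by simp
      also have "\<dots> = m * B - I\<^sup>2"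
        using \<open>m > 0\<close> by (simp add: field_simps power2_eq_square)
      finally show ?thesis by simp
    qed
    moreover have "(cmod (\<integral>x. f x \<partial>M))\<^sup>2 \<le> I\<^sup>2"
      unfolding I_def by (intro power_mono integral_norm_bound) auto
    ultimately have "ennreal ((cmod (\<integral>x. f x \<partial>M))\<^sup>2) \<le> ennreal (m * B)"
      by (intro ennreal_leI) simp
    also have "\<dots> = ennreal m * (\<integral>\<^sup>+x. ennreal ((cmod (f x))\<^sup>2) \<partial>M)"
      using if2 by (subst ennreal_mult') (auto simp: m_def B_def nn_integral_eq_integral)
    finally show ?thesis by (simp add: em)
  next
    case False
    then have inf: "(\<integral>\<^sup>+x. ennreal ((cmod (f x))\<^sup>2) \<partial>M) = \<infinity>"
      by (simp add: L2_iff less_top[symmetric])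
    have "emeasure M (space M) \<noteq> 0"
    proof
      assume "emeasure M (space M) = 0"
      then have "AE x in M. ennreal ((cmod (f x))\<^sup>2) = 0"
        by (intro AE_I[of _ _ "space M"]) auto
      then have "(\<integral>\<^sup>+x. ennreal ((cmod (f x))\<^sup>2) \<partial>M) = 0"
        by (simp add: nn_integral_0_iff_AE)
      then show False using inf by simp
    qed
    then show ?thesis by (simp add: inf ennreal_mult_top)
  qed
qed

section \<open>Measurability of rotations and rotation angles\<close>

lemma space_SO3_measure [simp]: "space SO3_measure = SO3"
  by (simp add: SO3_measure_def space_restrict_space)

lemma sets_SO3_measure [measurable_cong]: "sets SO3_measure = sets (restrict_space borel SO3)"
  by (simp add: SO3_measure_def)

lemma space_angles [simp]: "space angles = {0..pi}"
  by (simp add: angles_def space_restrict_space)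

lemma finite_measure_SO3_measure: "finite_measure SO3_measure"
  by (rule finite_measureI) (simp add: emeasure_SO3_measure)

lemma measurable_SO3_borel [measurable]: "(\<lambda>A. A) \<in> SO3_measure \<rightarrow>\<^sub>M borel"
  unfolding measurable_cong_sets[OF sets_SO3_measure refl] by (rule measurable_restrict_space1) simp

lemma measurable_angles_borel [measurable]: "(\<lambda>\<omega>. \<omega>) \<in> angles \<rightarrow>\<^sub>M borel"
  unfolding angles_def by (rule measurable_id_restrict_lborel)

lemma measurable_sphere_borel [measurable]: "(\<lambda>\<xi>. \<xi>) \<in> sphere_measure \<rightarrow>\<^sub>M borel"
  by (rule measurable_id_sphere_measure)

lemma measurable_SO3I:
  assumes "f \<in> borel_measurable M" "\<And>x. x \<in> space M \<Longrightarrow> f x \<in> SO3"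
  shows "f \<in> M \<rightarrow>\<^sub>M SO3_measure"
  unfolding measurable_cong_sets[OF refl sets_SO3_measure]
  using assms by (intro measurable_restrict_space2) auto

lemma measurable_anglesI:
  assumes "f \<in> borel_measurable M" "\<And>x. x \<in> space M \<Longrightarrow> f x \<in> {0..pi}"
  shows "f \<in> M \<rightarrow>\<^sub>M angles"
  unfolding angles_def using assms by (intro measurable_restrict_space2) auto

lemma measurable_SO3_mult [measurable (raw)]:
  assumes "f \<in> M \<rightarrow>\<^sub>M SO3_measure" "g \<in> M \<rightarrow>\<^sub>M SO3_measure"
  shows "(\<lambda>x. f x ** g x) \<in> M \<rightarrow>\<^sub>M SO3_measure"
proof (rule measurable_SO3I)
  show "(\<lambda>x. f x ** g x) \<in> borel_measurable M"
    using assms by (intro borel_measurable_matrix_mult) (auto dest: measurable_compose[OF _ measurable_SO3_borel])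
  show "f x ** g x \<in> SO3" if "x \<in> space M" for x
    using assms[THEN measurable_space, OF that] by (simp add: SO3_closed_mult)
qed

lemma measurable_SO3_rot [measurable (raw)]:
  assumes "f \<in> M \<rightarrow>\<^sub>M sphere_measure" "g \<in> M \<rightarrow>\<^sub>M angles"
  shows "(\<lambda>x. rot (f x) (g x)) \<in> M \<rightarrow>\<^sub>M SO3_measure"
proof (rule measurable_SO3I)
  show "(\<lambda>x. rot (f x) (g x)) \<in> borel_measurable M"
    using measurable_compose[OF assms(1) measurable_sphere_borel]
      measurable_compose[OF assms(2) measurable_angles_borel] by (intro borel_measurable_rot)
  show "rot (f x) (g x) \<in> SO3" if "x \<in> space M" for x
    using measurable_space[OF assms(1) that] by (intro rot_in_SO3) simp
qed

lemma rot_angle_in: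
  assumes "Q \<in> SO3"
  shows "rot_angle Q \<in> {0..pi}"
  using SO3_trace_bounds[OF assms] by (simp add: rot_angle_def arccos_lbound arccos_ubound)

lemma rot_dist_in: "P \<in> SO3 \<Longrightarrow> Q \<in> SO3 \<Longrightarrow> rot_dist P Q \<in> {0..pi}"
  unfolding rot_dist_def by (intro rot_angle_in SO3_closed_mult SO3_transpose)

lemma rot_angle_rot:
  assumes "\<xi> \<in> sphere 0 1" "\<omega> \<in> {0..pi}"
  shows "rot_angle (rot \<xi> \<omega>) = \<omega>"
proof -
  have n: "\<xi>$1 * \<xi>$1 + \<xi>$2 * \<xi>$2 + \<xi>$3 * \<xi>$3 = 1"
    using assms by (simp add: norm_vec_def L2_set_def sum_3 power2_eq_square)
  have "trace (rot \<xi> \<omega>) = (1 - cos \<omega>) * (\<xi>$1 * \<xi>$1 + \<xi>$2 * \<xi>$2 + \<xi>$3 * \<xi>$3) + 3 * cos \<omega>"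
    by (simp add: trace_3 rot_def matrix_def cross3_def mat_def axis_def algebra_simps)
  then have "(trace (rot \<xi> \<omega>) - 1) / 2 = cos \<omega>" unfolding n by simp
  then show ?thesis using assms by (simp add: rot_angle_def arccos_cos)
qed

lemma measurable_rot_dist [measurable (raw)]:
  assumes "f \<in> M \<rightarrow>\<^sub>M SO3_measure" "g \<in> M \<rightarrow>\<^sub>M SO3_measure"
  shows "(\<lambda>x. rot_dist (f x) (g x)) \<in> M \<rightarrow>\<^sub>M angles"
proof (rule measurable_anglesI)
  have fg: "f x \<in> SO3" "g x \<in> SO3" if "x \<in> space M" for x
    using assms[THEN measurable_space, OF that] by auto
  then show "rot_dist (f x) (g x) \<in> {0..pi}" if "x \<in> space M" for x
    using that by (intro rot_dist_in)
  have [measurable]: "f \<in> borel_measurable M" "g \<in> borel_measurable M"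
    using assms by (auto dest: measurable_compose[OF _ measurable_SO3_borel])
  have [measurable]: "(\<lambda>A. A $ i $ j) \<in> borel_measurable (borel :: (real^3^3) measure)" for i j
    by (intro borel_measurable_continuous_onI continuous_intros)
  have "(\<lambda>x. trace (transpose (f x) ** g x)) \<in> borel_measurable M"
    unfolding trace_3 matrix_matrix_mult_def transpose_def by (simp add: sum_3)
  then have [measurable]: "(\<lambda>x. (trace (transpose (f x) ** g x) - 1) / 2) \<in> borel_measurable M"
    by measurable
  (* arccos is unspecified outside [-1, 1]; clamping its argument gives a continuous function. *)
  have [measurable]: "(\<lambda>t. arccos (max (-1) (min 1 t))) \<in> borel_measurable borel"
    by (intro borel_measurable_continuous_onI continuous_on_arccos continuous_intros) auto
  have "(\<lambda>x. arccos (max (-1) (min 1 ((trace (transpose (f x) ** g x) - 1) / 2)))) \<in> borel_measurable M"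
    by measurable
  moreover have "arccos (max (-1) (min 1 ((trace (transpose (f x) ** g x) - 1) / 2))) = rot_dist (f x) (g x)"
    if "x \<in> space M" for x
    using SO3_trace_bounds[OF SO3_closed_mult[OF SO3_transpose[OF fg(1)[OF that]] fg(2)[OF that]]]
    by (simp add: rot_dist_def rot_angle_def)
  ultimately show "(\<lambda>x. rot_dist (f x) (g x)) \<in> borel_measurable M"
    by (simp cong: measurable_cong)
qed

section \<open>Integration over translated rotations\<close>

lemma rot_dist_left_translate:
  assumes "Q \<in> SO3"
  shows "rot_dist Q (Q ** A) = rot_angle A"
proof -
  have "transpose Q ** (Q ** A) = A"
    using assms by (simp add: SO3_def rotation_matrix_def orthogonal_matrix matrix_mul_assoc)
  then show ?thesis by (simp add: rot_dist_def)
qed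

lemma closed_SO3: "closed SO3"
proof -
  have "SO3 = {Q. (\<forall>i j. (\<Sum>k\<in>UNIV. Q $ k $ i * Q $ k $ j) = mat 1 $ i $ j) \<and> det Q = 1}"
    by (auto simp: SO3_def rotation_matrix_def orthogonal_matrix vec_eq_iff
        matrix_matrix_mult_def transpose_def)
  also have "closed \<dots>"
    unfolding det_3
    by (intro closed_Collect_conj closed_Collect_all closed_Collect_eq continuous_intros)
  finally show ?thesis .
qed

text \<open>
  Sets measurable for the rotation measure are Borel sets of matrices because
  \<^const>\<open>SO3\<close> is closed, so the invariance for Borel functions on all matrices applies to their indicators.
\<close>

lemma distr_SO3_measure_left:
  assumes Q: "Q \<in> SO3"
  shows "distr SO3_measure SO3_measure (\<lambda>A. Q ** A) = SO3_measure"
proof (rule measure_eqI)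
  have [measurable]: "(\<lambda>A. Q ** A) \<in> SO3_measure \<rightarrow>\<^sub>M SO3_measure"
    using Q by (intro measurable_SO3_mult) auto
  have cl: "SO3 \<in> sets borel" by (intro borel_closed closed_SO3)
  fix X assume "X \<in> sets (distr SO3_measure SO3_measure (\<lambda>A. Q ** A))"
  then have X: "X \<in> sets SO3_measure" by simp
  then have Xb: "X \<in> sets borel" "X \<subseteq> SO3"
    using cl by (auto simp: sets_SO3_measure sets_restrict_space_iff)
  have "emeasure (distr SO3_measure SO3_measure (\<lambda>A. Q ** A)) X
      = (\<integral>\<^sup>+A. indicator X (Q ** A) \<partial>SO3_measure)"
    using X by (simp add: nn_integral_distr flip: nn_integral_indicator)
  also have "\<dots> = (\<integral>\<^sup>+A. indicator X A \<partial>SO3_measure)"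
    using Xb(1) Q by (intro nn_integral_SO3_measure_left_invariant) auto
  also have "\<dots> = emeasure SO3_measure X" using X by simp
  finally show "emeasure (distr SO3_measure SO3_measure (\<lambda>A. Q ** A)) X = emeasure SO3_measure X" .
qed simp

lemma nn_integral_SO3_left:
  assumes "Q \<in> SO3" and [measurable]: "f \<in> borel_measurable SO3_measure"
  shows "(\<integral>\<^sup>+A. f (Q ** A) \<partial>SO3_measure) = (\<integral>\<^sup>+A. f A \<partial>SO3_measure)"
proof -
  have [measurable]: "(\<lambda>A. Q ** A) \<in> SO3_measure \<rightarrow>\<^sub>M SO3_measure"
    using assms(1) by (intro measurable_SO3_mult) auto
  have "(\<integral>\<^sup>+A. f A \<partial>distr SO3_measure SO3_measure (\<lambda>A. Q ** A)) = (\<integral>\<^sup>+A. f (Q ** A) \<partial>SO3_measure)"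
    by (rule nn_integral_distr) measurable
  then show ?thesis by (simp add: distr_SO3_measure_left[OF assms(1)])
qed

lemma integral_SO3_left:
  fixes f :: "real^3^3 \<Rightarrow> complex"
  assumes "Q \<in> SO3" and [measurable]: "f \<in> borel_measurable SO3_measure"
  shows "(\<integral>A. f (Q ** A) \<partial>SO3_measure) = (\<integral>A. f A \<partial>SO3_measure)"
    and "integrable SO3_measure (\<lambda>A. f (Q ** A)) \<longleftrightarrow> integrable SO3_measure f"
proof -
  have [measurable]: "(\<lambda>A. Q ** A) \<in> SO3_measure \<rightarrow>\<^sub>M SO3_measure"
    using assms(1) by (intro measurable_SO3_mult) auto
  have "(\<integral>A. f A \<partial>distr SO3_measure SO3_measure (\<lambda>A. Q ** A)) = (\<integral>A. f (Q ** A) \<partial>SO3_measure)"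
    by (rule integral_distr) measurable
  then show "(\<integral>A. f (Q ** A) \<partial>SO3_measure) = (\<integral>A. f A \<partial>SO3_measure)"
    by (simp add: distr_SO3_measure_left[OF assms(1)])
  have "integrable (distr SO3_measure SO3_measure (\<lambda>A. Q ** A)) f \<longleftrightarrow> integrable SO3_measure (\<lambda>A. f (Q ** A))"
    by (rule integrable_distr_eq) measurable
  then show "integrable SO3_measure (\<lambda>A. f (Q ** A)) \<longleftrightarrow> integrable SO3_measure f"
    by (simp add: distr_SO3_measure_left[OF assms(1)])
qed

lemma SO3_measure_axis_angle:
  "SO3_measure = distr (density (angles \<Otimes>\<^sub>M sphere_measure) (\<lambda>p. ennreal (2 * (1 - cos (fst p)))))
     SO3_measure (\<lambda>p. rot (snd p) (fst p))"
  by (subst SO3_measure_def) (simp add: case_prod_unfold sets_SO3_measure cong: distr_cong)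

lemma nn_integral_SO3_axis_angle:
  assumes [measurable]: "f \<in> borel_measurable SO3_measure"
  shows "(\<integral>\<^sup>+A. f A \<partial>SO3_measure)
    = (\<integral>\<^sup>+\<omega>. \<integral>\<^sup>+\<xi>. ennreal (2 * (1 - cos \<omega>)) * f (rot \<xi> \<omega>) \<partial>sphere_measure \<partial>angles)"
proof -
  interpret S: finite_measure sphere_measure by (rule finite_measure_sphere_measure)
  have [measurable]: "(\<lambda>p. cos (fst p)) \<in> borel_measurable (angles \<Otimes>\<^sub>M sphere_measure)"
    by (rule measurable_compose[OF measurable_compose[OF measurable_fst measurable_angles_borel]]) measurable
  show ?thesis
    by (subst SO3_measure_axis_angle)
      (simp add: nn_integral_distr nn_integral_density S.nn_integral_fst[symmetric])
qed

lemma integral_SO3_axis_angle: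
  fixes f :: "real^3^3 \<Rightarrow> complex"
  assumes f: "integrable SO3_measure f"
  shows "(\<integral>A. f A \<partial>SO3_measure)
    = (\<integral>\<omega>. of_real (2 * (1 - cos \<omega>)) * (\<integral>\<xi>. f (rot \<xi> \<omega>) \<partial>sphere_measure) \<partial>angles)"
proof -
  interpret S: finite_measure sphere_measure by (rule finite_measure_sphere_measure)
  interpret A: sigma_finite_measure angles by (rule sigma_finite_angles)
  interpret P: pair_sigma_finite angles sphere_measure ..
  have [measurable]: "f \<in> borel_measurable SO3_measure" using f by auto
  have [measurable]: "(\<lambda>p. cos (fst p)) \<in> borel_measurable (angles \<Otimes>\<^sub>M sphere_measure)"
    by (rule measurable_compose[OF measurable_compose[OF measurable_fst measurable_angles_borel]]) measurable
  let ?g = "\<lambda>p. (2 * (1 - cos (fst p))) *\<^sub>R f (rot (snd p) (fst p))"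
  have "integrable (angles \<Otimes>\<^sub>M sphere_measure) ?g"
    using f by (subst (asm) SO3_measure_axis_angle) (simp add: integrable_distr_eq integrable_density)
  from P.integral_fst'[OF this] have "(\<integral>p. ?g p \<partial>(angles \<Otimes>\<^sub>M sphere_measure)) =
      (\<integral>\<omega>. of_real (2 * (1 - cos \<omega>)) * (\<integral>\<xi>. f (rot \<xi> \<omega>) \<partial>sphere_measure) \<partial>angles)"
    by (simp add: scaleR_conv_of_real)
  moreover have "(\<integral>A. f A \<partial>SO3_measure) = (\<integral>p. ?g p \<partial>(angles \<Otimes>\<^sub>M sphere_measure))"
    by (subst SO3_measure_axis_angle) (simp add: integral_distr integral_density)
  ultimately show ?thesis by simp
qed

section \<open>The Radon transform at a fixed rotation\<close>

lemma radon_at_eq: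
  "radon_at Q f \<omega> = of_real (2 * (1 - cos \<omega>)) * (\<integral>\<xi>. f (Q ** rot \<xi> \<omega>) \<partial>sphere_measure)"
  by (simp add: radon_at_def radon_def field_simps)

lemma radon_eq: "radon f (Q, \<omega>) = of_real (1 / (8 * pi\<^sup>2)) * radon_at Q f \<omega>"
  by (simp add: radon_at_def)

lemma measurable_radon:
  assumes [measurable]: "f \<in> borel_measurable SO3_measure"
  shows "radon f \<in> borel_measurable (SO3_measure \<Otimes>\<^sub>M angles)"
proof -
  interpret S: finite_measure sphere_measure by (rule finite_measure_sphere_measure)
  have [measurable]: "(\<lambda>p. cos (snd p)) \<in> borel_measurable (SO3_measure \<Otimes>\<^sub>M angles)"
    by (rule measurable_compose[OF measurable_compose[OF measurable_snd measurable_angles_borel]]) measurable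
  show ?thesis
    unfolding radon_def case_prod_unfold by measurable
qed

lemma measurable_radon_at:
  assumes "Q \<in> SO3" "f \<in> borel_measurable SO3_measure"
  shows "radon_at Q f \<in> borel_measurable angles"
proof -
  have "(\<lambda>\<omega>. radon f (Q, \<omega>)) \<in> borel_measurable angles"
    using assms by (intro measurable_compose[OF measurable_Pair1' measurable_radon]) auto
  then show ?thesis unfolding radon_at_def by measurable
qed

lemma measurable_rot_fibre:
  assumes "Q \<in> SO3" "\<omega> \<in> {0..pi}"
  shows "(\<lambda>\<xi>. Q ** rot \<xi> \<omega>) \<in> sphere_measure \<rightarrow>\<^sub>M SO3_measure"
  using assms by (intro measurable_SO3_mult measurable_SO3_rot measurable_const measurable_ident_sets) auto

lemma axis_angle_weight_bounds: "0 \<le> 2 * (1 - cos \<omega>)" "2 * (1 - cos \<omega>) \<le> (4 :: real)"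
proof -
  have "0 \<le> 2 * (1 - c)" "2 * (1 - c) \<le> 4" if "- 1 \<le> c" "c \<le> 1" for c :: real
    using that by auto
  from this[OF cos_ge_minus_one cos_le_one]
  show "0 \<le> 2 * (1 - cos \<omega>)" "2 * (1 - cos \<omega>) \<le> (4 :: real)" by blast+
qed

text \<open>
  By Cauchy-Schwarz on the sphere of area \<open>4\<pi>\<close> the squared value at \<open>\<omega>\<close> is at most
  \<open>w\<^sup>2 \<sqdot> 4\<pi>\<close> times the integral of \<open>\<bar>f\<bar>\<^sup>2\<close> over the rotations of angle \<open>\<omega>\<close>, where \<open>w = 2 (1 - cos \<omega>)\<close>. One factor
  \<open>w \<le> 4\<close> is absorbed in the constant and the other is the axis-angle density.
\<close>

lemma nn_integral_radon_at_le:
  assumes Q: "Q \<in> SO3" and [measurable]: "f \<in> borel_measurable SO3_measure"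
  shows "(\<integral>\<^sup>+\<omega>. ennreal ((cmod (radon_at Q f \<omega>))\<^sup>2) \<partial>angles)
    \<le> ennreal (16 * pi) * (\<integral>\<^sup>+A. ennreal ((cmod (f A))\<^sup>2) \<partial>SO3_measure)"
proof -
  interpret S: finite_measure sphere_measure by (rule finite_measure_sphere_measure)
  have [measurable]: "(\<lambda>A. Q ** A) \<in> SO3_measure \<rightarrow>\<^sub>M SO3_measure"
    using Q by (intro measurable_SO3_mult) auto
  have [measurable]: "cos \<in> borel_measurable angles"
    by (rule measurable_compose[OF measurable_angles_borel]) measurable
  have m[measurable]: "(\<lambda>\<xi>. f (Q ** rot \<xi> \<omega>)) \<in> borel_measurable sphere_measure" if "\<omega> \<in> {0..pi}" for \<omega>
    using measurable_rot_fibre[OF Q that] by measurable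
  have "(\<integral>\<^sup>+\<omega>. ennreal ((cmod (radon_at Q f \<omega>))\<^sup>2) \<partial>angles)
      \<le> (\<integral>\<^sup>+\<omega>. ennreal (16 * pi) * (\<integral>\<^sup>+\<xi>. ennreal (2 * (1 - cos \<omega>)) * ennreal ((cmod (f (Q ** rot \<xi> \<omega>)))\<^sup>2) \<partial>sphere_measure) \<partial>angles)"
  proof (rule nn_integral_mono)
    fix \<omega> assume "\<omega> \<in> space angles"
    then have w: "\<omega> \<in> {0..pi}" by simp
    define w where "w = 2 * (1 - cos \<omega>)"
    have w0: "0 \<le> w" "w \<le> 4" 
      unfolding w_def by (rule axis_angle_weight_bounds)+
    let ?I = "\<integral>\<xi>. f (Q ** rot \<xi> \<omega>) \<partial>sphere_measure"
    let ?N = "\<integral>\<^sup>+\<xi>. ennreal ((cmod (f (Q ** rot \<xi> \<omega>)))\<^sup>2) \<partial>sphere_measure"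
    have "(cmod (radon_at Q f \<omega>))\<^sup>2 = w * w * (cmod ?I)\<^sup>2"
      unfolding radon_at_eq w_def[symmetric] norm_mult norm_of_real
      by (simp add: power_mult_distrib power2_eq_square)
    (* Only one of the two factors w is estimated: the other one is the density of the measure. *)
    also have "\<dots> \<le> 4 * w * (cmod ?I)\<^sup>2"
      using w0 by (intro mult_right_mono) auto
    finally have "ennreal ((cmod (radon_at Q f \<omega>))\<^sup>2) \<le> ennreal (4 * w) * ennreal ((cmod ?I)\<^sup>2)"
      using w0 by (simp add: ennreal_mult[symmetric] ennreal_leI)
    also have "\<dots> \<le> ennreal (4 * w) * (ennreal (4 * pi) * ?N)"
      using norm_integral_squared_le[OF finite_measure_sphere_measure m[OF w]]
      by (intro mult_left_mono) (auto simp: emeasure_sphere_measure)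
    also have "\<dots> = ennreal (16 * pi) * (ennreal w * ?N)"
    proof -
      have "ennreal (4 * w) * ennreal (4 * pi) = ennreal (16 * pi) * ennreal w"
        using w0 by (simp add: ennreal_mult[symmetric] mult_ac)
      then show ?thesis by (simp only: mult.assoc[symmetric])
    qed
    also have "ennreal w * ?N = (\<integral>\<^sup>+\<xi>. ennreal w * ennreal ((cmod (f (Q ** rot \<xi> \<omega>)))\<^sup>2) \<partial>sphere_measure)"
      using w by (intro nn_integral_cmult[symmetric]) measurable
    finally show "ennreal ((cmod (radon_at Q f \<omega>))\<^sup>2) \<le> ennreal (16 * pi) * (\<integral>\<^sup>+\<xi>. ennreal (2 * (1 - cos \<omega>)) * ennreal ((cmod (f (Q ** rot \<xi> \<omega>)))\<^sup>2) \<partial>sphere_measure)"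
      by (simp add: w_def)
  qed
  also have "\<dots> = ennreal (16 * pi) * (\<integral>\<^sup>+\<omega>. \<integral>\<^sup>+\<xi>. ennreal (2 * (1 - cos \<omega>)) *
      ennreal ((cmod (f (Q ** rot \<xi> \<omega>)))\<^sup>2) \<partial>sphere_measure \<partial>angles)"
  proof (rule nn_integral_cmult)
    have "(\<lambda>p. ennreal (2 * (1 - cos (fst p))) * ennreal ((cmod (f (Q ** rot (snd p) (fst p))))\<^sup>2))
        \<in> borel_measurable (angles \<Otimes>\<^sub>M sphere_measure)"
      by measurable
    then show "(\<lambda>\<omega>. \<integral>\<^sup>+\<xi>. ennreal (2 * (1 - cos \<omega>)) * ennreal ((cmod (f (Q ** rot \<xi> \<omega>)))\<^sup>2) \<partial>sphere_measure)
        \<in> borel_measurable angles"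
      by (intro S.borel_measurable_nn_integral) (simp add: case_prod_unfold)
  qed
  also have "(\<integral>\<^sup>+\<omega>. \<integral>\<^sup>+\<xi>. ennreal (2 * (1 - cos \<omega>)) *
      ennreal ((cmod (f (Q ** rot \<xi> \<omega>)))\<^sup>2) \<partial>sphere_measure \<partial>angles)
    = (\<integral>\<^sup>+A. ennreal ((cmod (f (Q ** A)))\<^sup>2) \<partial>SO3_measure)"
    by (rule nn_integral_SO3_axis_angle[symmetric]) measurable
  also have "\<dots> = (\<integral>\<^sup>+A. ennreal ((cmod (f A))\<^sup>2) \<partial>SO3_measure)"
    by (rule nn_integral_SO3_left[OF Q]) measurable
  finally show ?thesis .
qed

text \<open>
  After translation by \<open>Q\<close> the integrand depends on the rotation angle alone, so the
  left side is the integral of \<open>\<bar>g(\<omega>)\<bar>\<^sup>2\<close> with the weight \<open>2 (1 - cos \<omega>) \<sqdot> 4\<pi> \<le> 16\<pi>\<close>.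
\<close>

lemma nn_integral_rot_dist_le:
  assumes Q: "Q \<in> SO3" and [measurable]: "g \<in> borel_measurable angles"
  shows "(\<integral>\<^sup>+A. ennreal ((cmod (g (rot_dist Q A)))\<^sup>2) \<partial>SO3_measure)
    \<le> ennreal (16 * pi) * (\<integral>\<^sup>+\<omega>. ennreal ((cmod (g \<omega>))\<^sup>2) \<partial>angles)"
proof -
  interpret S: finite_measure sphere_measure by (rule finite_measure_sphere_measure)
  have rd[measurable]: "(\<lambda>A. rot_dist Q A) \<in> SO3_measure \<rightarrow>\<^sub>M angles"
    using Q by (intro measurable_rot_dist) auto
  have ra: "rot_angle = rot_dist (mat 1)" by (rule ext) (simp add: rot_dist_def)
  have [measurable]: "rot_angle \<in> SO3_measure \<rightarrow>\<^sub>M angles"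
    unfolding ra by (intro measurable_rot_dist) (auto simp: SO3_def rotation_matrix_def orthogonal_matrix_id)
  have "(\<integral>\<^sup>+A. ennreal ((cmod (g (rot_dist Q A)))\<^sup>2) \<partial>SO3_measure)
      = (\<integral>\<^sup>+A. ennreal ((cmod (g (rot_dist Q (Q ** A))))\<^sup>2) \<partial>SO3_measure)"
    by (rule nn_integral_SO3_left[OF Q, symmetric]) measurable
  also have "\<dots> = (\<integral>\<^sup>+A. ennreal ((cmod (g (rot_angle A)))\<^sup>2) \<partial>SO3_measure)"
    by (simp add: rot_dist_left_translate[OF Q])
  also have "\<dots> = (\<integral>\<^sup>+\<omega>. \<integral>\<^sup>+\<xi>. ennreal (2 * (1 - cos \<omega>)) * ennreal ((cmod (g (rot_angle (rot \<xi> \<omega>))))\<^sup>2) \<partial>sphere_measure \<partial>angles)"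
    by (rule nn_integral_SO3_axis_angle) measurable
  also have "\<dots> \<le> (\<integral>\<^sup>+\<omega>. ennreal (16 * pi) * ennreal ((cmod (g \<omega>))\<^sup>2) \<partial>angles)"
  proof (rule nn_integral_mono)
    fix \<omega> assume "\<omega> \<in> space angles"
    then have w: "\<omega> \<in> {0..pi}" by simp
    have "(\<integral>\<^sup>+\<xi>. ennreal (2 * (1 - cos \<omega>)) * ennreal ((cmod (g (rot_angle (rot \<xi> \<omega>))))\<^sup>2) \<partial>sphere_measure)
      = (\<integral>\<^sup>+\<xi>. ennreal (2 * (1 - cos \<omega>)) * ennreal ((cmod (g \<omega>))\<^sup>2) \<partial>sphere_measure)"
      using w by (intro nn_integral_cong) (simp add: rot_angle_rot)
    also have "\<dots> = ennreal (2 * (1 - cos \<omega>) * (4 * pi)) * ennreal ((cmod (g \<omega>))\<^sup>2)"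
      by (simp add: emeasure_sphere_measure ennreal_mult[symmetric] mult_ac)
    also have "\<dots> \<le> ennreal (16 * pi) * ennreal ((cmod (g \<omega>))\<^sup>2)"
    proof (intro mult_right_mono ennreal_leI)
      from mult_right_mono[OF axis_angle_weight_bounds(2)[of \<omega>], of "4 * pi"] show "2 * (1 - cos \<omega>) * (4 * pi) \<le> 16 * pi" by simp
    qed simp
    finally show "(\<integral>\<^sup>+\<xi>. ennreal (2 * (1 - cos \<omega>)) * ennreal ((cmod (g (rot_angle (rot \<xi> \<omega>))))\<^sup>2) \<partial>sphere_measure)
      \<le> ennreal (16 * pi) * ennreal ((cmod (g \<omega>))\<^sup>2)" .
  qed
  also have "\<dots> = ennreal (16 * pi) * (\<integral>\<^sup>+\<omega>. ennreal ((cmod (g \<omega>))\<^sup>2) \<partial>angles)"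
    by (rule nn_integral_cmult) measurable
  finally show ?thesis .
qed

text \<open>
  Additivity of the transform requires the integrals over the single spheres to
  converge, which square integrability on \<open>SO(3)\<close> yields for almost every angle. The
  angle \<open>\<omega> = 0\<close>, where the density \<open>1 - cos \<omega>\<close> vanishes, is excluded; there the transform is 0 anyway.
\<close>

lemma AE_integrable_fibre:
  assumes Q: "Q \<in> SO3" and f: "f \<in> L2 SO3_measure"
  shows "AE \<omega> in angles. cos \<omega> \<noteq> 1 \<longrightarrow> integrable sphere_measure (\<lambda>\<xi>. f (Q ** rot \<xi> \<omega>))"
proof -
  interpret S: finite_measure sphere_measure by (rule finite_measure_sphere_measure)
  have fm[measurable]: "f \<in> borel_measurable SO3_measure" using f by (simp add: L2_def)
  have [measurable]: "(\<lambda>A. Q ** A) \<in> SO3_measure \<rightarrow>\<^sub>M SO3_measure"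
    using Q by (intro measurable_SO3_mult) auto
  have [measurable]: "cos \<in> borel_measurable angles"
    by (rule measurable_compose[OF measurable_angles_borel]) measurable
  have m[measurable]: "(\<lambda>\<xi>. f (Q ** rot \<xi> \<omega>)) \<in> borel_measurable sphere_measure" if "\<omega> \<in> {0..pi}" for \<omega>
    using measurable_rot_fibre[OF Q that] by measurable
  let ?F = "\<lambda>\<omega>. \<integral>\<^sup>+\<xi>. ennreal (2 * (1 - cos \<omega>)) * ennreal ((cmod (f (Q ** rot \<xi> \<omega>)))\<^sup>2) \<partial>sphere_measure"
  have "(\<lambda>p. ennreal (2 * (1 - cos (fst p))) * ennreal ((cmod (f (Q ** rot (snd p) (fst p))))\<^sup>2))
      \<in> borel_measurable (angles \<Otimes>\<^sub>M sphere_measure)"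
    by measurable
  then have "?F \<in> borel_measurable angles"
    by (intro S.borel_measurable_nn_integral) (simp add: case_prod_unfold)
  moreover have "(\<integral>\<^sup>+\<omega>. ?F \<omega> \<partial>angles) \<noteq> \<infinity>"
  proof -
    have "(\<integral>\<^sup>+\<omega>. ?F \<omega> \<partial>angles) = (\<integral>\<^sup>+A. ennreal ((cmod (f (Q ** A)))\<^sup>2) \<partial>SO3_measure)"
      by (rule nn_integral_SO3_axis_angle[symmetric]) measurable
    also have "\<dots> = (\<integral>\<^sup>+A. ennreal ((cmod (f A))\<^sup>2) \<partial>SO3_measure)"
      by (rule nn_integral_SO3_left[OF Q]) measurable
    finally show ?thesis using f by (simp add: L2_iff)
  qed
  ultimately have "AE \<omega> in angles. ?F \<omega> \<noteq> \<infinity>" by (rule nn_integral_PInf_AE)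
  then show ?thesis
  proof (rule AE_mp, intro AE_I2 impI)
    fix \<omega> assume w: "\<omega> \<in> space angles" and F: "?F \<omega> \<noteq> \<infinity>" and c: "cos \<omega> \<noteq> 1"
    then have w: "\<omega> \<in> {0..pi}" by simp
    have "cos \<omega> < 1" using c cos_le_one[of \<omega>] by (rule le_neq_trans[rotated])
    moreover have "?F \<omega> = ennreal (2 * (1 - cos \<omega>)) * (\<integral>\<^sup>+\<xi>. ennreal ((cmod (f (Q ** rot \<xi> \<omega>)))\<^sup>2) \<partial>sphere_measure)"
      using w by (intro nn_integral_cmult) measurable
    ultimately have "(\<integral>\<^sup>+\<xi>. ennreal ((cmod (f (Q ** rot \<xi> \<omega>)))\<^sup>2) \<partial>sphere_measure) \<noteq> \<infinity>"
      using F by (auto simp: ennreal_mult_top ennreal_eq_0_iff)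
    then have "(\<lambda>\<xi>. f (Q ** rot \<xi> \<omega>)) \<in> L2 sphere_measure"
      using m[OF w] by (simp add: L2_iff less_top)
    then show "integrable sphere_measure (\<lambda>\<xi>. f (Q ** rot \<xi> \<omega>))"
      by (rule L2_integrable_finite[OF finite_measure_sphere_measure])
  qed
qed

lemma AE_radon_at_add:
  assumes Q: "Q \<in> SO3" and f: "f \<in> L2 SO3_measure" and h: "h \<in> L2 SO3_measure"
  shows "AE \<omega> in angles. radon_at Q (\<lambda>A. f A + h A) \<omega> = radon_at Q f \<omega> + radon_at Q h \<omega>"
  using AE_integrable_fibre[OF Q f] AE_integrable_fibre[OF Q h]
proof eventually_elim
  case (elim \<omega>)
  show ?case
  proof (cases "cos \<omega> = 1")
    case False
    with elim show ?thesis by (simp add: radon_at_eq distrib_left)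
  qed (simp add: radon_at_eq)
qed

lemma radon_at_cmult: "radon_at Q (\<lambda>A. c * f A) \<omega> = c * radon_at Q f \<omega>"
  by (simp add: radon_at_eq)

lemma L2_rot_dist:
  assumes "Q \<in> SO3" "g \<in> L2 angles"
  shows "(\<lambda>A. g (rot_dist Q A)) \<in> L2 SO3_measure"
    and "L2_norm SO3_measure (\<lambda>A. g (rot_dist Q A)) \<le> sqrt (16 * pi) * L2_norm angles g"
proof -
  have g: "g \<in> borel_measurable angles" using assms(2) by (simp add: L2_def)
  have "(\<lambda>A. rot_dist Q A) \<in> SO3_measure \<rightarrow>\<^sub>M angles"
    using assms(1) by (intro measurable_rot_dist) auto
  then have m: "(\<lambda>A. g (rot_dist Q A)) \<in> borel_measurable SO3_measure"
    using g by (rule measurable_compose)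
  show "(\<lambda>A. g (rot_dist Q A)) \<in> L2 SO3_measure"
    and "L2_norm SO3_measure (\<lambda>A. g (rot_dist Q A)) \<le> sqrt (16 * pi) * L2_norm angles g"
    using L2_operator_boundI[OF assms(2) m _ nn_integral_rot_dist_le[OF assms(1) g]] by auto
qed

lemma L2_radon_at:
  assumes "Q \<in> SO3" "f \<in> L2 SO3_measure"
  shows "radon_at Q f \<in> L2 angles"
    and "L2_norm angles (radon_at Q f) \<le> sqrt (16 * pi) * L2_norm SO3_measure f"
proof -
  have f: "f \<in> borel_measurable SO3_measure" using assms(2) by (simp add: L2_def)
  show "radon_at Q f \<in> L2 angles"
    and "L2_norm angles (radon_at Q f) \<le> sqrt (16 * pi) * L2_norm SO3_measure f"
    using L2_operator_boundI[OF assms(2) measurable_radon_at[OF assms(1) f] _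
        nn_integral_radon_at_le[OF assms(1) f]] by auto
qed

text \<open>
  The integrand \<open>h\<close> on the right is translated by \<open>Q\<close> and integrated in axis-angle coordinates;
  the factor containing \<open>g\<close> is then constant on the spheres of fixed angle and leaves the inner integral.
\<close>

lemma radon_at_adjoint:
  assumes Q: "Q \<in> SO3" and f: "f \<in> L2 SO3_measure" and g: "g \<in> L2 angles"
  shows "(\<integral>\<omega>. radon_at Q f \<omega> * cnj (g \<omega>) \<partial>angles) = (\<integral>A. f A * cnj (g (rot_dist Q A)) \<partial>SO3_measure)"
proof -
  let ?h = "\<lambda>A. f A * cnj (g (rot_dist Q A))"
  have h: "integrable SO3_measure ?h"
    using f L2_rot_dist(1)[OF Q g] by (rule L2_mult_cnj_integrable)
  then have hm: "?h \<in> borel_measurable SO3_measure" by auto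
  have "(\<integral>A. ?h A \<partial>SO3_measure) = (\<integral>A. ?h (Q ** A) \<partial>SO3_measure)"
    by (rule integral_SO3_left(1)[OF Q hm, symmetric])
  also have "\<dots> = (\<integral>\<omega>. of_real (2 * (1 - cos \<omega>)) * (\<integral>\<xi>. ?h (Q ** rot \<xi> \<omega>) \<partial>sphere_measure) \<partial>angles)"
    using integral_SO3_left(2)[OF Q hm] h by (intro integral_SO3_axis_angle) simp
  also have "\<dots> = (\<integral>\<omega>. radon_at Q f \<omega> * cnj (g \<omega>) \<partial>angles)"
  proof (rule Bochner_Integration.integral_cong[OF refl])
    fix \<omega> assume "\<omega> \<in> space angles"
    then have "(\<integral>\<xi>. ?h (Q ** rot \<xi> \<omega>) \<partial>sphere_measure)
        = (\<integral>\<xi>. f (Q ** rot \<xi> \<omega>) * cnj (g \<omega>) \<partial>sphere_measure)"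
      by (intro Bochner_Integration.integral_cong[OF refl])
        (simp add: rot_dist_left_translate[OF Q] rot_angle_rot)
    then show "of_real (2 * (1 - cos \<omega>)) * (\<integral>\<xi>. ?h (Q ** rot \<xi> \<omega>) \<partial>sphere_measure)
        = radon_at Q f \<omega> * cnj (g \<omega>)"
      by (simp add: radon_at_eq)
  qed
  finally show ?thesis ..
qed

lemma is_L2_adjoint_radon_at:
  assumes Q: "Q \<in> SO3"
  shows "is_L2_adjoint SO3_measure angles (radon_at Q) (\<lambda>g A. g (rot_dist Q A))"
  unfolding is_L2_adjoint_def L2_bounded_linear_def
proof (intro conjI ballI allI)
  show "\<exists>C. \<forall>f\<in>L2 SO3_measure. L2_norm angles (radon_at Q f) \<le> C * L2_norm SO3_measure f"
    using L2_radon_at(2)[OF Q] by blast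
  show "\<exists>C. \<forall>g\<in>L2 angles. L2_norm SO3_measure (\<lambda>A. g (rot_dist Q A)) \<le> C * L2_norm angles g"
    using L2_rot_dist(2)[OF Q] by blast
qed (use Q in \<open>auto simp: L2_radon_at(1) L2_rot_dist(1) AE_radon_at_add radon_at_cmult
      L2_inner_def radon_at_adjoint\<close>)

section \<open>The Radon transform in both variables\<close>

abbreviation rot_average :: "((real^3^3) \<times> real \<Rightarrow> complex) \<Rightarrow> real^3^3 \<Rightarrow> complex" where
  "rot_average g A \<equiv> of_real (1 / (8 * pi\<^sup>2)) * (\<integral>P. g (P, rot_dist P A) \<partial>SO3_measure)"

lemma measurable_rot_dist_pair [measurable (raw)]:
  assumes [measurable]: "g \<in> borel_measurable (SO3_measure \<Otimes>\<^sub>M angles)"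
  shows "(\<lambda>(P, A). g (P, rot_dist P A)) \<in> borel_measurable (SO3_measure \<Otimes>\<^sub>M SO3_measure)"
  unfolding case_prod_unfold by measurable

text \<open>
  The bound for one rotation, integrated over that rotation. It controls both
  the norm of the averaging operator and the integrability needed to exchange integrals.
\<close>

lemma nn_integral_rot_dist_pair_le:
  assumes [measurable]: "g \<in> borel_measurable (SO3_measure \<Otimes>\<^sub>M angles)"
  shows "(\<integral>\<^sup>+p. ennreal ((cmod (g (fst p, rot_dist (fst p) (snd p))))\<^sup>2) \<partial>(SO3_measure \<Otimes>\<^sub>M SO3_measure))
    \<le> ennreal (16 * pi) * (\<integral>\<^sup>+p. ennreal ((cmod (g p))\<^sup>2) \<partial>(SO3_measure \<Otimes>\<^sub>M angles))"
proof -
  interpret S: finite_measure SO3_measure by (rule finite_measure_SO3_measure)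
  interpret A: sigma_finite_measure angles by (rule sigma_finite_angles)
  have "(\<integral>\<^sup>+p. ennreal ((cmod (g (fst p, rot_dist (fst p) (snd p))))\<^sup>2) \<partial>(SO3_measure \<Otimes>\<^sub>M SO3_measure))
      = (\<integral>\<^sup>+P. \<integral>\<^sup>+A. ennreal ((cmod (g (P, rot_dist P A)))\<^sup>2) \<partial>SO3_measure \<partial>SO3_measure)"
    by (subst S.nn_integral_fst[symmetric]) simp_all
  also have "\<dots> \<le> (\<integral>\<^sup>+P. ennreal (16 * pi) * (\<integral>\<^sup>+\<omega>. ennreal ((cmod (g (P, \<omega>)))\<^sup>2) \<partial>angles) \<partial>SO3_measure)"
  proof (rule nn_integral_mono)
    fix P assume "P \<in> space SO3_measure"
    then have "P \<in> SO3" "(\<lambda>\<omega>. g (P, \<omega>)) \<in> borel_measurable angles"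
      by (auto intro: measurable_compose[OF measurable_Pair1' assms])
    then show "(\<integral>\<^sup>+A. ennreal ((cmod (g (P, rot_dist P A)))\<^sup>2) \<partial>SO3_measure)
        \<le> ennreal (16 * pi) * (\<integral>\<^sup>+\<omega>. ennreal ((cmod (g (P, \<omega>)))\<^sup>2) \<partial>angles)"
      by (rule nn_integral_rot_dist_le)
  qed
  also have "\<dots> = ennreal (16 * pi) * (\<integral>\<^sup>+P. \<integral>\<^sup>+\<omega>. ennreal ((cmod (g (P, \<omega>)))\<^sup>2) \<partial>angles \<partial>SO3_measure)"
    by (rule nn_integral_cmult) measurable
  also have "(\<integral>\<^sup>+P. \<integral>\<^sup>+\<omega>. ennreal ((cmod (g (P, \<omega>)))\<^sup>2) \<partial>angles \<partial>SO3_measure)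
      = (\<integral>\<^sup>+p. ennreal ((cmod (g p))\<^sup>2) \<partial>(SO3_measure \<Otimes>\<^sub>M angles))"
    by (subst A.nn_integral_fst[symmetric]) simp_all
  finally show ?thesis .
qed

lemma L2_rot_dist_pair:
  assumes "g \<in> L2 (SO3_measure \<Otimes>\<^sub>M angles)"
  shows "(\<lambda>(P, A). g (P, rot_dist P A)) \<in> L2 (SO3_measure \<Otimes>\<^sub>M SO3_measure)"
proof -
  have g: "g \<in> borel_measurable (SO3_measure \<Otimes>\<^sub>M angles)" using assms by (simp add: L2_def)
  show ?thesis
    by (rule L2_operator_boundI(1)[OF assms measurable_rot_dist_pair[OF g], of "16 * pi"])
      (use nn_integral_rot_dist_pair_le[OF g] in \<open>simp_all add: case_prod_unfold\<close>)
qed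

lemma AE_rot_dist_integrable:
  assumes "g \<in> L2 (SO3_measure \<Otimes>\<^sub>M angles)"
  shows "AE A in SO3_measure. integrable SO3_measure (\<lambda>P. g (P, rot_dist P A))"
proof -
  interpret S: finite_measure SO3_measure by (rule finite_measure_SO3_measure)
  interpret P: pair_sigma_finite SO3_measure SO3_measure ..
  have "finite_measure (SO3_measure \<Otimes>\<^sub>M SO3_measure)"
    by (rule finite_measure_pair_measure[OF finite_measure_SO3_measure finite_measure_SO3_measure])
  then have "integrable (SO3_measure \<Otimes>\<^sub>M SO3_measure) (\<lambda>(P, A). g (P, rot_dist P A))"
    using L2_rot_dist_pair[OF assms] by (rule L2_integrable_finite)
  then show ?thesis by (rule P.AE_integrable_snd)
qed

lemma measurable_rot_average:
  assumes [measurable]: "g \<in> borel_measurable (SO3_measure \<Otimes>\<^sub>M angles)"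
  shows "(\<lambda>A. rot_average g A) \<in> borel_measurable SO3_measure"
proof -
  interpret S: finite_measure SO3_measure by (rule finite_measure_SO3_measure)
  show ?thesis by measurable
qed

text \<open>
  In the bound, \<open>8\<pi>\<^sup>2\<close> is the total mass, which enters through Cauchy-Schwarz, and \<open>16\<pi>\<close> is the
  bound for \<open>g \<mapsto> g(P, d\<^sub>P(A))\<close> on the product space.
\<close>

lemma L2_rot_average:
  assumes g2: "g \<in> L2 (SO3_measure \<Otimes>\<^sub>M angles)"
  shows "(\<lambda>A. rot_average g A) \<in> L2 SO3_measure"
    and "L2_norm SO3_measure (\<lambda>A. rot_average g A)
      \<le> sqrt ((1 / (8 * pi\<^sup>2))\<^sup>2 * (8 * pi\<^sup>2) * (16 * pi)) * L2_norm (SO3_measure \<Otimes>\<^sub>M angles) g"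
proof -
  interpret S: finite_measure SO3_measure by (rule finite_measure_SO3_measure)
  interpret P: pair_sigma_finite SO3_measure SO3_measure ..
  have g[measurable]: "g \<in> borel_measurable (SO3_measure \<Otimes>\<^sub>M angles)" using g2 by (simp add: L2_def)
  let ?c = "1 / (8 * pi\<^sup>2)"
  let ?N = "\<integral>\<^sup>+p. ennreal ((cmod (g p))\<^sup>2) \<partial>(SO3_measure \<Otimes>\<^sub>M angles)"
  let ?k = "ennreal (?c\<^sup>2 * (8 * pi\<^sup>2))"
  have "(\<integral>\<^sup>+A. ennreal ((cmod (rot_average g A))\<^sup>2) \<partial>SO3_measure)
      \<le> (\<integral>\<^sup>+A. ?k * (\<integral>\<^sup>+P. ennreal ((cmod (g (P, rot_dist P A)))\<^sup>2) \<partial>SO3_measure) \<partial>SO3_measure)"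
  proof (rule nn_integral_mono)
    fix A assume "A \<in> space SO3_measure"
    then have "(\<lambda>P. g (P, rot_dist P A)) \<in> borel_measurable SO3_measure"
      by (intro measurable_compose[OF _ g] measurable_Pair measurable_rot_dist measurable_const
          measurable_ident_sets) auto
    from norm_integral_squared_le[OF finite_measure_SO3_measure this]
    have le: "ennreal ((cmod (\<integral>P. g (P, rot_dist P A) \<partial>SO3_measure))\<^sup>2)
        \<le> ennreal (8 * pi\<^sup>2) * (\<integral>\<^sup>+P. ennreal ((cmod (g (P, rot_dist P A)))\<^sup>2) \<partial>SO3_measure)"
      by (simp add: emeasure_SO3_measure)
    have "ennreal ((cmod (rot_average g A))\<^sup>2)
        = ennreal (?c\<^sup>2) * ennreal ((cmod (\<integral>P. g (P, rot_dist P A) \<partial>SO3_measure))\<^sup>2)"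
      unfolding norm_mult norm_of_real power_mult_distrib by (subst ennreal_mult) auto
    also have "\<dots> \<le> ennreal (?c\<^sup>2) * (ennreal (8 * pi\<^sup>2) *
        (\<integral>\<^sup>+P. ennreal ((cmod (g (P, rot_dist P A)))\<^sup>2) \<partial>SO3_measure))"
      by (intro mult_left_mono le) simp
    also have "\<dots> = ?k * (\<integral>\<^sup>+P. ennreal ((cmod (g (P, rot_dist P A)))\<^sup>2) \<partial>SO3_measure)"
      by (subst mult.assoc[symmetric], subst ennreal_mult[symmetric]) auto
    finally show "ennreal ((cmod (rot_average g A))\<^sup>2)
        \<le> ?k * (\<integral>\<^sup>+P. ennreal ((cmod (g (P, rot_dist P A)))\<^sup>2) \<partial>SO3_measure)" .
  qed
  also have "\<dots> = ?k * (\<integral>\<^sup>+A. \<integral>\<^sup>+P. ennreal ((cmod (g (P, rot_dist P A)))\<^sup>2) \<partial>SO3_measure \<partial>SO3_measure)"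
    by (rule nn_integral_cmult) measurable
  also have "(\<integral>\<^sup>+A. \<integral>\<^sup>+P. ennreal ((cmod (g (P, rot_dist P A)))\<^sup>2) \<partial>SO3_measure \<partial>SO3_measure)
      = (\<integral>\<^sup>+p. ennreal ((cmod (g (fst p, rot_dist (fst p) (snd p))))\<^sup>2) \<partial>(SO3_measure \<Otimes>\<^sub>M SO3_measure))"
    by (subst P.nn_integral_snd[symmetric]) simp_all
  also have "?k * \<dots> \<le> ?k * (ennreal (16 * pi) * ?N)"
    by (intro mult_left_mono nn_integral_rot_dist_pair_le) auto
  also have "\<dots> = ennreal (?c\<^sup>2 * (8 * pi\<^sup>2) * (16 * pi)) * ?N"
    by (subst mult.assoc[symmetric], subst ennreal_mult[symmetric]) auto
  finally have le: "(\<integral>\<^sup>+A. ennreal ((cmod (rot_average g A))\<^sup>2) \<partial>SO3_measure)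
      \<le> ennreal (?c\<^sup>2 * (8 * pi\<^sup>2) * (16 * pi)) * ?N" .
  have c0: "0 \<le> ?c\<^sup>2 * (8 * pi\<^sup>2) * (16 * pi)" by simp
  show "(\<lambda>A. rot_average g A) \<in> L2 SO3_measure"
    and "L2_norm SO3_measure (\<lambda>A. rot_average g A)
      \<le> sqrt (?c\<^sup>2 * (8 * pi\<^sup>2) * (16 * pi)) * L2_norm (SO3_measure \<Otimes>\<^sub>M angles) g"
    using L2_operator_boundI[OF g2 measurable_rot_average[OF g] c0 le] by auto
qed

lemma L2_radon:
  assumes f2: "f \<in> L2 SO3_measure"
  shows "radon f \<in> L2 (SO3_measure \<Otimes>\<^sub>M angles)"
    and "L2_norm (SO3_measure \<Otimes>\<^sub>M angles) (radon f)
      \<le> sqrt ((1 / (8 * pi\<^sup>2))\<^sup>2 * (16 * pi) * (8 * pi\<^sup>2)) * L2_norm SO3_measure f"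
proof -
  interpret A: sigma_finite_measure angles by (rule sigma_finite_angles)
  have f: "f \<in> borel_measurable SO3_measure" using f2 by (simp add: L2_def)
  note r[measurable] = measurable_radon[OF f]
  let ?c = "1 / (8 * pi\<^sup>2)"
  let ?N = "\<integral>\<^sup>+A. ennreal ((cmod (f A))\<^sup>2) \<partial>SO3_measure"
  have "(\<integral>\<^sup>+p. ennreal ((cmod (radon f p))\<^sup>2) \<partial>(SO3_measure \<Otimes>\<^sub>M angles))
      = (\<integral>\<^sup>+P. \<integral>\<^sup>+\<omega>. ennreal ((cmod (radon f (P, \<omega>)))\<^sup>2) \<partial>angles \<partial>SO3_measure)"
    by (subst A.nn_integral_fst[symmetric]) simp_all
  also have "\<dots> \<le> (\<integral>\<^sup>+P. ennreal (?c\<^sup>2 * (16 * pi)) * ?N \<partial>SO3_measure)"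
  proof (rule nn_integral_mono)
    fix P assume "P \<in> space SO3_measure"
    then have P: "P \<in> SO3" by simp
    note [measurable] = measurable_radon_at[OF P f]
    have "(\<integral>\<^sup>+\<omega>. ennreal ((cmod (radon f (P, \<omega>)))\<^sup>2) \<partial>angles)
        = (\<integral>\<^sup>+\<omega>. ennreal (?c\<^sup>2) * ennreal ((cmod (radon_at P f \<omega>))\<^sup>2) \<partial>angles)"
      unfolding radon_eq norm_mult norm_of_real power_mult_distrib
      by (subst ennreal_mult) auto
    also have "\<dots> = ennreal (?c\<^sup>2) * (\<integral>\<^sup>+\<omega>. ennreal ((cmod (radon_at P f \<omega>))\<^sup>2) \<partial>angles)"
      by (rule nn_integral_cmult) measurable
    also have "\<dots> \<le> ennreal (?c\<^sup>2) * (ennreal (16 * pi) * ?N)"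
      by (intro mult_left_mono nn_integral_radon_at_le[OF P f]) simp
    also have "\<dots> = ennreal (?c\<^sup>2 * (16 * pi)) * ?N"
      by (subst mult.assoc[symmetric], subst ennreal_mult[symmetric]) auto
    finally show "(\<integral>\<^sup>+\<omega>. ennreal ((cmod (radon f (P, \<omega>)))\<^sup>2) \<partial>angles) \<le> ennreal (?c\<^sup>2 * (16 * pi)) * ?N" .
  qed
  also have "\<dots> = ennreal (?c\<^sup>2 * (16 * pi)) * ?N * ennreal (8 * pi\<^sup>2)"
    by (simp only: nn_integral_const space_SO3_measure emeasure_SO3_measure)
  also have "\<dots> = ennreal (?c\<^sup>2 * (16 * pi) * (8 * pi\<^sup>2)) * ?N"
    by (subst ennreal_mult[of "?c\<^sup>2 * (16 * pi)"]) (auto simp only: mult.assoc mult.commute mult.left_commute, simp_all)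
  finally have le: "(\<integral>\<^sup>+p. ennreal ((cmod (radon f p))\<^sup>2) \<partial>(SO3_measure \<Otimes>\<^sub>M angles))
      \<le> ennreal (?c\<^sup>2 * (16 * pi) * (8 * pi\<^sup>2)) * ?N" .
  have c0: "0 \<le> ?c\<^sup>2 * (16 * pi) * (8 * pi\<^sup>2)" by simp
  show "radon f \<in> L2 (SO3_measure \<Otimes>\<^sub>M angles)"
    and "L2_norm (SO3_measure \<Otimes>\<^sub>M angles) (radon f)
      \<le> sqrt (?c\<^sup>2 * (16 * pi) * (8 * pi\<^sup>2)) * L2_norm SO3_measure f"
    using L2_operator_boundI[OF f2 r c0 le] by auto
qed

lemma AE_radon_add:
  assumes f: "f \<in> L2 SO3_measure" and h: "h \<in> L2 SO3_measure"
  shows "AE p in SO3_measure \<Otimes>\<^sub>M angles. radon (\<lambda>A. f A + h A) p = radon f p + radon h p"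
proof -
  interpret S: finite_measure SO3_measure by (rule finite_measure_SO3_measure)
  interpret A: sigma_finite_measure angles by (rule sigma_finite_angles)
  interpret P: pair_sigma_finite SO3_measure angles ..
  have fh: "f \<in> borel_measurable SO3_measure" "h \<in> borel_measurable SO3_measure"
    using f h by (auto simp: L2_def)
  then have "(\<lambda>A. f A + h A) \<in> borel_measurable SO3_measure" by measurable
  note [measurable] = fh[THEN measurable_radon] measurable_radon[OF this]
  show ?thesis
  proof (rule P.AE_pair_measure)
    show "{p \<in> space (SO3_measure \<Otimes>\<^sub>M angles). radon (\<lambda>A. f A + h A) p = radon f p + radon h p}
        \<in> sets (SO3_measure \<Otimes>\<^sub>M angles)"
      by measurable
    show "AE P in SO3_measure. AE \<omega> in angles.
        radon (\<lambda>A. f A + h A) (P, \<omega>) = radon f (P, \<omega>) + radon h (P, \<omega>)"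
    proof (rule AE_I2)
      fix P assume "P \<in> space SO3_measure"
      then have "AE \<omega> in angles. radon_at P (\<lambda>A. f A + h A) \<omega> = radon_at P f \<omega> + radon_at P h \<omega>"
        using f h by (intro AE_radon_at_add) auto
      then show "AE \<omega> in angles. radon (\<lambda>A. f A + h A) (P, \<omega>) = radon f (P, \<omega>) + radon h (P, \<omega>)"
        by eventually_elim (simp only: radon_eq distrib_left)
    qed
  qed
qed

text \<open>
  For almost every \<open>P\<close> the function \<open>g(P, \<cdot>)\<close> is square integrable, and the adjoint formula at the fixed
  rotation \<open>P\<close> applies. Fubini then exchanges \<open>P\<close> and \<open>A\<close>; its integrability hypothesis holds because
  both factors of the integrand are square integrable on the product.
\<close>

lemma radon_adjoint:
  assumes f: "f \<in> L2 SO3_measure" and g: "g \<in> L2 (SO3_measure \<Otimes>\<^sub>M angles)"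
  shows "(\<integral>p. radon f p * cnj (g p) \<partial>(SO3_measure \<Otimes>\<^sub>M angles))
    = (\<integral>A. f A * cnj (rot_average g A) \<partial>SO3_measure)"
proof -
  interpret S: finite_measure SO3_measure by (rule finite_measure_SO3_measure)
  interpret A: sigma_finite_measure angles by (rule sigma_finite_angles)
  interpret SA: pair_sigma_finite SO3_measure angles ..
  interpret SS: pair_sigma_finite SO3_measure SO3_measure ..
  have gm[measurable]: "g \<in> borel_measurable (SO3_measure \<Otimes>\<^sub>M angles)" using g by (simp add: L2_def)
  have fm[measurable]: "f \<in> borel_measurable SO3_measure" using f by (simp add: L2_def)
  let ?c = "of_real (1 / (8 * pi\<^sup>2)) :: complex"
  have gP: "AE P in SO3_measure. (\<lambda>\<omega>. g (P, \<omega>)) \<in> L2 angles"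
  proof -
    have "integrable (SO3_measure \<Otimes>\<^sub>M angles) (\<lambda>p. (cmod (g p))\<^sup>2)" using g by (simp add: L2_def)
    from SA.AE_integrable_fst'[OF this] show ?thesis
    proof (rule AE_mp, intro AE_I2 impI)
      fix P assume "P \<in> space SO3_measure" "integrable angles (\<lambda>\<omega>. (cmod (g (P, \<omega>)))\<^sup>2)"
      then show "(\<lambda>\<omega>. g (P, \<omega>)) \<in> L2 angles"
        by (auto simp: L2_def intro: measurable_compose[OF measurable_Pair1' gm])
    qed
  qed
  have f2: "(\<lambda>p. f (snd p)) \<in> L2 (SO3_measure \<Otimes>\<^sub>M SO3_measure)"
  proof -
    have "(\<integral>\<^sup>+p. ennreal ((cmod (f (snd p)))\<^sup>2) \<partial>(SO3_measure \<Otimes>\<^sub>M SO3_measure))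
        = (\<integral>\<^sup>+P. \<integral>\<^sup>+A. ennreal ((cmod (f A))\<^sup>2) \<partial>SO3_measure \<partial>SO3_measure)"
      by (subst S.nn_integral_fst[symmetric]) simp_all
    also have "\<dots> < \<infinity>"
      using f by (simp add: L2_iff emeasure_SO3_measure ennreal_mult_less_top)
    finally show ?thesis by (simp add: L2_iff)
  qed
  have FI: "integrable (SO3_measure \<Otimes>\<^sub>M SO3_measure) (\<lambda>(P, A). f A * cnj (g (P, rot_dist P A)))"
    using L2_mult_cnj_integrable[OF f2 L2_rot_dist_pair[OF g]] by (simp add: case_prod_unfold)
  have "(\<integral>p. radon f p * cnj (g p) \<partial>(SO3_measure \<Otimes>\<^sub>M angles))
      = (\<integral>P. \<integral>\<omega>. radon f (P, \<omega>) * cnj (g (P, \<omega>)) \<partial>angles \<partial>SO3_measure)"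
    by (rule SA.integral_fst'[symmetric]) (rule L2_mult_cnj_integrable[OF L2_radon(1)[OF f] g])
  also have "\<dots> = (\<integral>P. ?c * (\<integral>A. f A * cnj (g (P, rot_dist P A)) \<partial>SO3_measure) \<partial>SO3_measure)"
  proof (rule integral_cong_AE)
    show "AE P in SO3_measure. (\<integral>\<omega>. radon f (P, \<omega>) * cnj (g (P, \<omega>)) \<partial>angles)
        = ?c * (\<integral>A. f A * cnj (g (P, rot_dist P A)) \<partial>SO3_measure)"
      using gP
    proof (rule AE_mp, intro AE_I2 impI)
      fix P assume P: "P \<in> space SO3_measure" and g: "(\<lambda>\<omega>. g (P, \<omega>)) \<in> L2 angles"
      have "(\<integral>\<omega>. radon f (P, \<omega>) * cnj (g (P, \<omega>)) \<partial>angles)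
          = ?c * (\<integral>\<omega>. radon_at P f \<omega> * cnj (g (P, \<omega>)) \<partial>angles)"
        unfolding radon_eq mult.assoc by (rule integral_mult_right_zero)
      then show "(\<integral>\<omega>. radon f (P, \<omega>) * cnj (g (P, \<omega>)) \<partial>angles)
        = ?c * (\<integral>A. f A * cnj (g (P, rot_dist P A)) \<partial>SO3_measure)"
        using radon_at_adjoint[OF _ f g] P by simp
    qed
    show "(\<lambda>P. \<integral>\<omega>. radon f (P, \<omega>) * cnj (g (P, \<omega>)) \<partial>angles) \<in> borel_measurable SO3_measure"
      using SA.integrable_fst'[OF L2_mult_cnj_integrable[OF L2_radon(1)[OF f] g]] by auto
    show "(\<lambda>P. ?c * (\<integral>A. f A * cnj (g (P, rot_dist P A)) \<partial>SO3_measure)) \<in> borel_measurable SO3_measure"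
      using SS.integrable_fst'[OF FI] by auto
  qed
  also have "\<dots> = ?c * (\<integral>P. \<integral>A. f A * cnj (g (P, rot_dist P A)) \<partial>SO3_measure \<partial>SO3_measure)"
    by (rule integral_mult_right_zero)
  also have "\<dots> = ?c * (\<integral>A. \<integral>P. f A * cnj (g (P, rot_dist P A)) \<partial>SO3_measure \<partial>SO3_measure)"
    using SS.Fubini_integral[OF FI] by simp
  also have "\<dots> = (\<integral>A. f A * cnj (rot_average g A) \<partial>SO3_measure)"
    by (subst integral_mult_right_zero[symmetric]) (simp add: mult_ac)
  finally show ?thesis .
qed

lemma is_L2_adjoint_radon:
  "is_L2_adjoint SO3_measure (SO3_measure \<Otimes>\<^sub>M angles) radon (\<lambda>g A. rot_average g A)"
  unfolding is_L2_adjoint_def L2_bounded_linear_def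
proof (intro conjI ballI allI)
  show "\<exists>C. \<forall>f\<in>L2 SO3_measure. L2_norm (SO3_measure \<Otimes>\<^sub>M angles) (radon f) \<le> C * L2_norm SO3_measure f"
    using L2_radon(2) by blast
  show "\<exists>C. \<forall>g\<in>L2 (SO3_measure \<Otimes>\<^sub>M angles).
      L2_norm SO3_measure (\<lambda>A. rot_average g A) \<le> C * L2_norm (SO3_measure \<Otimes>\<^sub>M angles) g"
    using L2_rot_average(2) by blast
  fix g h :: "(real^3^3) \<times> real \<Rightarrow> complex"
  assume "g \<in> L2 (SO3_measure \<Otimes>\<^sub>M angles)" "h \<in> L2 (SO3_measure \<Otimes>\<^sub>M angles)"
  from this[THEN AE_rot_dist_integrable]
  show "AE A in SO3_measure. rot_average (\<lambda>p. g p + h p) A = rot_average g A + rot_average h A"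
    by eventually_elim (simp add: distrib_left)
next
  fix c :: complex and f :: "real^3^3 \<Rightarrow> complex"
  show "AE p in SO3_measure \<Otimes>\<^sub>M angles. radon (\<lambda>A. c * f A) p = c * radon f p"
    by (rule AE_I2) (simp add: radon_def case_prod_unfold)
next
  fix c :: complex and g :: "(real^3^3) \<times> real \<Rightarrow> complex"
  show "AE A in SO3_measure. rot_average (\<lambda>p. c * g p) A = c * rot_average g A"
    by (rule AE_I2) simp
qed (assumption | rule L2_radon(1) L2_rot_average(1) AE_radon_add radon_adjoint[folded L2_inner_def])+

theorem theorem4p4:
  fixes Q :: "real^3^3"
  assumes "Q \<in> SO3"
  shows "is_L2_adjoint SO3_measure angles (radon_at Q) (\<lambda>g A. g (rot_dist Q A)) \<and>
         is_L2_adjoint SO3_measure (SO3_measure \<Otimes>\<^sub>M angles) radon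
           (\<lambda>g A. of_real (1 / (8 * pi\<^sup>2)) * (\<integral>P. g (P, rot_dist P A) \<partial>SO3_measure))"
  using is_L2_adjoint_radon_at[OF assms] is_L2_adjoint_radon by blast

end
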